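(* Suppose the change-point and response models depend on an unknown random parameter $\eta$ with prior distribution $\tilde\mu$ on a Polish space $\mathcal H$. Fix an assignment rule $\mathcal X$ and an integer $t\ge0$. For any measurable subset $C\subset\mathcal H$, almost surely, $$\mathsf P(\eta\in C\mid\mathcal F_t)=\frac{\int D_{t,\tilde\eta}(1+\Gamma_{t,\tilde\eta})\mathbf 1\{\tilde\eta\in C\}\,d\tilde\mu(\tilde\eta)}{\int D_{t,\tilde\eta}(1+\Gamma_{t,\tilde\eta})\,d\tilde\mu(\tilde\eta)}.$$
   Context: Setup. Fix $2\le K<\infty$, $[K]=\{1,\dots,K\}$, $\mathbb N=\{1,2,\dots\}$. There is a latent process $L_t\in\{0,1\}$, $t\ge0$, with $L_t=0$ for $t<\Theta$ and $L_t=1$ for $t\ge\Theta$ ($\Theta$ is the change-point). At each $t\in\mathbb N$ a treatment $X_t\in[K]$ is selected and a response $Y_t$ in a Polish space $\mathbb Y$ is observed; $\mathcal F_t=\sigma(X_s,Y_s:1\le s\le t)$, and $\mathcal F_0$ is trivial. An assignment rule is a sequence $\mathcal X=\{X_t,t\in\mathbb N\}$ with $X_1$ deterministic and $X_t$ a deterministic (measurable) function of $X_1,\dots,X_{t-1},Y_1,\dots,Y_{t-1}$ for $t\ge2$. Parametric models: $\eta$ is random with law $\tilde\mu$ on the Polish space $\mathcal H$. For each $\eta\in\mathcal H$ there are $\pi_{0,\eta}\in[0,1)$, functions $\pi_{t,\eta}:[K]^t\to[0,1)$, $t\in\mathbb N$, and densities $f_{x,\eta},g_{x,\eta}$, $x\in[K]$,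 with respect to a $\sigma$-finite measure $\mu$ on the Borel $\sigma$-algebra of $\mathbb Y$. Conditionally on $\eta$: $\mathsf P(L_0=1)=\pi_{0,\eta}$; given $L_{t-1}=0$, $\mathcal F_{t-1}$ and $X_t$, $L_t=1$ with probability $\Pi_{t,\eta}=\pi_{t,\eta}(X_1,\dots,X_t)$; given $X_t=x$, $L_t=i$, $\mathcal F_{t-1}$ and $L_0,\dots,L_{t-1}$, the response $Y_t$ has density $f_{x,\eta}$ if $i=0$ and $g_{x,\eta}$ if $i=1$. Definitions: $\Gamma_{0,\eta}=\pi_{0,\eta}/(1-\pi_{0,\eta})$ and, for $t\in\mathbb N$, $\Gamma_{t,\eta}=(\Gamma_{t-1,\eta}+\Pi_{t,\eta})\dfrac{\Lambda_{t,\eta}}{1-\Pi_{t,\eta}}$ with $\Lambda_{t,\eta}=\dfrac{g_{X_t,\eta}(Y_t)}{f_{X_t,\eta}(Y_t)}$; $D_{0,\eta}=1-\pi_{0,\eta}$ and $D_{t,\eta}=D_{0,\eta}\prod_{s=1}^t(1-\Pi_{s,\eta})f_{X_s,\eta}(Y_s)$ for $t\ge1$.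
   Formalization: Added assumption: for every η and x, the density g_{x,η} vanishes μ-almost everywhere where f_{x,η} vanishes; otherwise Λ = g/f can be infinite while D = 0, so that D(1+Γ) is undefined with positive probability. *)

theory Defs
  imports "HOL-Probability.Probability" "HOL-Library.Extended_Nat"
begin

section \<open>Sigma-algebras generated by random variables\<close>

definition preimages :: "'w measure \<Rightarrow> ('w \<Rightarrow> 'a) \<Rightarrow> 'a measure \<Rightarrow> 'w set set" where
  "preimages M Z N = {Z -` A \<inter> space M | A. A \<in> sets N}"

definition obs_preimages ::
  "'w measure \<Rightarrow> (nat \<Rightarrow> 'w \<Rightarrow> nat) \<Rightarrow> (nat \<Rightarrow> 'w \<Rightarrow> 'y::polish_space) \<Rightarrow> nat \<Rightarrow> 'w set set" where
  "obs_preimages M X Y t =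
     (\<Union>s\<in>{1..t}. preimages M (X s) (count_space UNIV) \<union> preimages M (Y s) borel)"

text \<open>The observation filtration; for \<open>t = 0\<close> there are no generators and the sigma-algebra
  is trivial.\<close>

definition obs_algebra ::
  "'w measure \<Rightarrow> (nat \<Rightarrow> 'w \<Rightarrow> nat) \<Rightarrow> (nat \<Rightarrow> 'w \<Rightarrow> 'y::polish_space) \<Rightarrow> nat \<Rightarrow> 'w measure" where
  "obs_algebra M X Y t = sigma (space M) (obs_preimages M X Y t)"

definition cprob :: "'w measure \<Rightarrow> 'w measure \<Rightarrow> 'w set \<Rightarrow> 'w \<Rightarrow> real" where
  "cprob M G A = real_cond_exp M G (indicator A)"


section \<open>The change-point model\<close>

text \<open>The change-point may be infinite: the hazards below do not force a change ever to occur.\<close>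

definition latent :: "('w \<Rightarrow> enat) \<Rightarrow> nat \<Rightarrow> 'w \<Rightarrow> nat" where
  "latent \<Theta> t \<omega> = (if enat t < \<Theta> \<omega> then 0 else 1)"

definition assignment_rule ::
  "'w measure \<Rightarrow> nat \<Rightarrow> (nat \<Rightarrow> 'w \<Rightarrow> nat) \<Rightarrow> (nat \<Rightarrow> 'w \<Rightarrow> 'y::polish_space) \<Rightarrow> bool" where
  "assignment_rule M K X Y \<longleftrightarrow>
     (\<exists>a\<in>{1..K}. \<forall>\<omega>\<in>space M. X 1 \<omega> = a) \<and>
     (\<forall>t\<ge>2. \<exists>\<phi> \<in> measurable
         (PiM {1..<t} (\<lambda>_. count_space {1..K}) \<Otimes>\<^sub>M PiM {1..<t} (\<lambda>_. borel)) (count_space {1..K}).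
       \<forall>\<omega>\<in>space M. X t \<omega> = \<phi> (\<lambda>s\<in>{1..<t}. X s \<omega>, \<lambda>s\<in>{1..<t}. Y s \<omega>))"

definition hazard ::
  "(nat \<Rightarrow> 'h \<Rightarrow> (nat \<Rightarrow> nat) \<Rightarrow> real) \<Rightarrow> (nat \<Rightarrow> 'w \<Rightarrow> nat) \<Rightarrow> nat \<Rightarrow> 'h \<Rightarrow> 'w \<Rightarrow> real" where
  "hazard p X t h \<omega> = p t h (\<lambda>s\<in>{1..t}. X s \<omega>)"

definition likelihood_ratio ::
  "(nat \<Rightarrow> 'h \<Rightarrow> 'y \<Rightarrow> real) \<Rightarrow> (nat \<Rightarrow> 'h \<Rightarrow> 'y \<Rightarrow> real) \<Rightarrow> (nat \<Rightarrow> 'w \<Rightarrow> nat) \<Rightarrow> (nat \<Rightarrow> 'w \<Rightarrow> 'y) \<Rightarrow>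
   nat \<Rightarrow> 'h \<Rightarrow> 'w \<Rightarrow> real" where
  "likelihood_ratio f g X Y t h \<omega> = g (X t \<omega>) h (Y t \<omega>) / f (X t \<omega>) h (Y t \<omega>)"

primrec change_odds ::
  "('h \<Rightarrow> real) \<Rightarrow> (nat \<Rightarrow> 'h \<Rightarrow> (nat \<Rightarrow> nat) \<Rightarrow> real) \<Rightarrow>
   (nat \<Rightarrow> 'h \<Rightarrow> 'y \<Rightarrow> real) \<Rightarrow> (nat \<Rightarrow> 'h \<Rightarrow> 'y \<Rightarrow> real) \<Rightarrow> (nat \<Rightarrow> 'w \<Rightarrow> nat) \<Rightarrow> (nat \<Rightarrow> 'w \<Rightarrow> 'y) \<Rightarrow>
   nat \<Rightarrow> 'h \<Rightarrow> 'w \<Rightarrow> real" where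
  "change_odds p\<^sub>0 p f g X Y 0 h \<omega> = p\<^sub>0 h / (1 - p\<^sub>0 h)"
| "change_odds p\<^sub>0 p f g X Y (Suc t) h \<omega> =
     (change_odds p\<^sub>0 p f g X Y t h \<omega> + hazard p X (Suc t) h \<omega>) *
     (likelihood_ratio f g X Y (Suc t) h \<omega> / (1 - hazard p X (Suc t) h \<omega>))"

definition no_change_likelihood ::
  "('h \<Rightarrow> real) \<Rightarrow> (nat \<Rightarrow> 'h \<Rightarrow> (nat \<Rightarrow> nat) \<Rightarrow> real) \<Rightarrow>
   (nat \<Rightarrow> 'h \<Rightarrow> 'y \<Rightarrow> real) \<Rightarrow> (nat \<Rightarrow> 'w \<Rightarrow> nat) \<Rightarrow> (nat \<Rightarrow> 'w \<Rightarrow> 'y) \<Rightarrow>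
   nat \<Rightarrow> 'h \<Rightarrow> 'w \<Rightarrow> real" where
  "no_change_likelihood p\<^sub>0 p f X Y t h \<omega> =
     (1 - p\<^sub>0 h) * (\<Prod>s=1..t. (1 - hazard p X s h \<omega>) * f (X s \<omega>) h (Y s \<omega>))"

text \<open>
  Treatments are \<open>{1..K}\<close> and treatment histories of length \<open>t\<close> are the elements of
  \<open>PiE {1..t} (\<lambda>_. {1..K})\<close>. Only the values of \<open>X\<close> and \<open>Y\<close> at times \<open>t \<ge> 1\<close> matter.
  ``Conditionally on \<open>\<eta>\<close>'' is expressed by including \<open>\<eta>\<close> among the generators of the
  conditioning sigma-algebra.

  The premise \<open>ratio_defined\<close> is what makes the likelihood ratio meaningful:
  where \<open>f\<close> vanishes and \<open>g\<close> does not, the ratio is infinite and its product with the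
  (vanishing) no-change likelihood is undefined. On the remaining set where both densities
  vanish, the value of the ratio is irrelevant.
\<close>

locale change_point_model = prob_space M
  for M :: "'w measure" +
  fixes K :: nat
    and \<Theta> :: "'w \<Rightarrow> enat"
    and X :: "nat \<Rightarrow> 'w \<Rightarrow> nat"
    and Y :: "nat \<Rightarrow> 'w \<Rightarrow> 'y::polish_space"
    and \<eta> :: "'w \<Rightarrow> 'h::polish_space"
    and prior :: "'h measure"
    and \<mu> :: "'y measure"
    and p\<^sub>0 :: "'h \<Rightarrow> real"
    and p :: "nat \<Rightarrow> 'h \<Rightarrow> (nat \<Rightarrow> nat) \<Rightarrow> real"
    and f g :: "nat \<Rightarrow> 'h \<Rightarrow> 'y \<Rightarrow> real"
  assumes K_ge_2: "2 \<le> K"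
    and Theta_measurable: "\<Theta> \<in> measurable M (count_space UNIV)"
    and Y_measurable: "\<And>t. 1 \<le> t \<Longrightarrow> Y t \<in> measurable M borel"
    and X_rule: "assignment_rule M K X Y"
    and eta_measurable: "\<eta> \<in> measurable M borel"
    and eta_law: "distr M borel \<eta> = prior"
    and mu_sets: "sets \<mu> = sets borel"
    and mu_sigma_finite: "sigma_finite_measure \<mu>"
    and p0_measurable: "p\<^sub>0 \<in> borel_measurable borel"
    and p0_range: "\<And>h. 0 \<le> p\<^sub>0 h \<and> p\<^sub>0 h < 1"
    and p_measurable: "\<And>t x. 1 \<le> t \<Longrightarrow> x \<in> PiE {1..t} (\<lambda>_. {1..K}) \<Longrightarrow>
          (\<lambda>h. p t h x) \<in> borel_measurable borel"
    and p_range: "\<And>t h x. 1 \<le> t \<Longrightarrow> x \<in> PiE {1..t} (\<lambda>_. {1..K}) \<Longrightarrow>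
          0 \<le> p t h x \<and> p t h x < 1"
    and f_measurable: "\<And>x. x \<in> {1..K} \<Longrightarrow>
          (\<lambda>(h, y). f x h y) \<in> borel_measurable (borel \<Otimes>\<^sub>M borel)"
    and g_measurable: "\<And>x. x \<in> {1..K} \<Longrightarrow>
          (\<lambda>(h, y). g x h y) \<in> borel_measurable (borel \<Otimes>\<^sub>M borel)"
    and f_nonneg: "\<And>x h y. x \<in> {1..K} \<Longrightarrow> 0 \<le> f x h y"
    and g_nonneg: "\<And>x h y. x \<in> {1..K} \<Longrightarrow> 0 \<le> g x h y"
    and f_density: "\<And>x h. x \<in> {1..K} \<Longrightarrow> (\<integral>\<^sup>+y. ennreal (f x h y) \<partial>\<mu>) = 1"
    and g_density: "\<And>x h. x \<in> {1..K} \<Longrightarrow> (\<integral>\<^sup>+y. ennreal (g x h y) \<partial>\<mu>) = 1"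
    and ratio_defined: "\<And>x h. x \<in> {1..K} \<Longrightarrow> AE y in \<mu>. f x h y = 0 \<longrightarrow> g x h y = 0"
    and initial_law: "AE \<omega> in M.
          cprob M (sigma (space M) (preimages M \<eta> borel)) {\<omega> \<in> space M. latent \<Theta> 0 \<omega> = 1} \<omega>
          = p\<^sub>0 (\<eta> \<omega>)"
    and transition_law: "\<And>t. 1 \<le> t \<Longrightarrow> AE \<omega> in M. latent \<Theta> (t - 1) \<omega> = 0 \<longrightarrow>
          cprob M
            (sigma (space M)
              (preimages M \<eta> borel \<union> preimages M (latent \<Theta> (t - 1)) (count_space UNIV) \<union>
               obs_preimages M X Y (t - 1) \<union> preimages M (X t) (count_space UNIV)))
            {\<omega> \<in> space M. latent \<Theta> t \<omega> = 1} \<omega>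
          = hazard p X t (\<eta> \<omega>) \<omega>"
    and response_law: "\<And>t B. 1 \<le> t \<Longrightarrow> B \<in> sets borel \<Longrightarrow> AE \<omega> in M.
          cprob M
            (sigma (space M)
              (preimages M \<eta> borel \<union> (\<Union>s\<in>{0..t}. preimages M (latent \<Theta> s) (count_space UNIV)) \<union>
               obs_preimages M X Y (t - 1) \<union> preimages M (X t) (count_space UNIV)))
            {\<omega> \<in> space M. Y t \<omega> \<in> B} \<omega>
          = (LINT y:B|\<mu>. if latent \<Theta> t \<omega> = 0 then f (X t \<omega>) (\<eta> \<omega>) y else g (X t \<omega>) (\<eta> \<omega>) y)"

end

theory Submission
  imports Defs
begin

text \<open>
  Given \<open>\<eta> = h\<close>, the joint density \<open>\<ell> t i\<close> of the observations up to time \<open>t\<close> and of the event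
  \<open>L\<^sub>t = i\<close> satisfies the forward recursion of a two-state hidden Markov model, and
  \<open>\<ell> t 0 = D\<^sub>t\<close>, while \<open>\<ell> t 1 = D\<^sub>t \<Gamma>\<^sub>t\<close> almost everywhere (where no likelihood ratio has the form
  \<open>c / 0\<close> with \<open>c \<noteq> 0\<close>). Instead of the law of the whole history, the induction
  carries Bayes' formula itself: on \<open>\<F>\<^sub>t\<close>, the conditional law of \<open>\<eta>\<close> on \<open>L\<^sub>t = i\<close> has density
  \<open>\<ell> t i / N\<^sub>t\<close> with respect to the prior, where \<open>N\<^sub>t = \<integral> \<ell> t 0 + \<ell> t 1\<close>. The transition and response
  laws then give the conditional density of \<open>(\<eta>, Y\<^bsub>t+1\<^esub>)\<close> given \<open>\<F>\<^sub>t\<close>; integrating out \<open>\<eta>\<close> gives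
  the density \<open>N\<^bsub>t+1\<^esub> / N\<^sub>t\<close> of \<open>Y\<^bsub>t+1\<^esub>\<close>, and the quotient of the two is the formula at time \<open>t + 1\<close>.
\<close>

section \<open>Generated sigma-algebras and conditional densities\<close>

lemma preimages_subset_Pow: "preimages M Z N \<subseteq> Pow (space M)"
  by (auto simp: preimages_def)

lemma preimages_subset_sets:
  assumes "space G = space M" "Z \<in> measurable G N"
  shows "preimages M Z N \<subseteq> sets G"
  using assms by (auto simp: preimages_def intro: measurable_sets simp flip: assms(1))

lemma measurable_sigma_preimages:
  assumes "S \<subseteq> Pow (space M)" "preimages M Z N \<subseteq> S" "Z \<in> space M \<rightarrow> space N"
  shows "Z \<in> measurable (sigma (space M) S) N"
proof (rule measurableI)
  fix B assume "B \<in> sets N"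
  then have "Z -` B \<inter> space M \<in> S" using assms(2) by (auto simp: preimages_def)
  then show "Z -` B \<inter> space (sigma (space M) S) \<in> sets (sigma (space M) S)"
    using assms(1) by (simp add: space_measure_of sets_measure_of)
qed (use assms in \<open>auto simp: space_measure_of\<close>)

lemma sigma_subset_sets:
  assumes "space G = space M" "S \<subseteq> sets G"
  shows "sets (sigma (space M) S) \<subseteq> sets G"
proof -
  have "S \<subseteq> Pow (space M)" using assms sets.sets_into_space by blast
  then show ?thesis using assms sets.sigma_sets_subset[of S G] by (simp add: sets_measure_of)
qed

lemma subalgebra_sigma:
  assumes "S \<subseteq> sets M"
  shows "subalgebra M (sigma (space M) S)"
  using sigma_subset_sets[OF refl assms] assms sets.sets_into_space
  by (auto simp: subalgebra_def space_measure_of_conv)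

lemma (in prob_space) cprob_nn_integral:
  assumes G: "subalgebra M G" and B: "B \<in> sets M" and f: "f \<in> borel_measurable G"
  shows "(\<integral>\<^sup>+\<omega>. f \<omega> * indicator B \<omega> \<partial>M) = (\<integral>\<^sup>+\<omega>. f \<omega> * ennreal (cprob M G B \<omega>) \<partial>M)"
proof -
  interpret S: sigma_finite_subalgebra M G
    by (intro finite_measure_subalgebra_is_sigma_finite finite_measure_subalgebra.intro
        finite_measure_axioms finite_measure_subalgebra_axioms.intro G)
  note B[measurable]
  have "AE \<omega> in M. nn_cond_exp M G (indicator B) \<omega> \<le> nn_cond_exp M G (\<lambda>_. 1) \<omega>"
    by (rule S.nn_cond_exp_mono) (auto simp: indicator_def)
  moreover have "AE \<omega> in M. 1 = nn_cond_exp M G (\<lambda>_. 1) \<omega>"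
    by (rule S.nn_cond_exp_F_meas) simp
  moreover have "AE \<omega> in M. 0 = nn_cond_exp M G (\<lambda>_. 0) \<omega>"
    by (rule S.nn_cond_exp_F_meas) simp
  ultimately have "AE \<omega> in M. ennreal (cprob M G B \<omega>) = nn_cond_exp M G (indicator B) \<omega>"
  proof eventually_elim
    case (elim \<omega>)
    have "(\<lambda>x. ennreal (- indicator B x)) = (\<lambda>_. 0)"
      by (auto simp: indicator_def fun_eq_iff ennreal_neg)
    then show ?case using elim
      by (auto simp: cprob_def real_cond_exp_def ennreal_indicator ennreal_enn2real_if top_unique)
  qed
  then have "(\<integral>\<^sup>+\<omega>. f \<omega> * ennreal (cprob M G B \<omega>) \<partial>M)
      = (\<integral>\<^sup>+\<omega>. f \<omega> * nn_cond_exp M G (indicator B) \<omega> \<partial>M)"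
    by (intro nn_integral_cong_AE) auto
  then show ?thesis using S.nn_cond_exp_intg[OF f, of "indicator B"] by simp
qed

lemma (in prob_space) cprob_compl:
  assumes G: "subalgebra M G" and B: "B \<in> sets M"
  shows "AE \<omega> in M. cprob M G (space M - B) \<omega> = 1 - cprob M G B \<omega>"
proof -
  interpret S: sigma_finite_subalgebra M G
    by (intro finite_measure_subalgebra_is_sigma_finite finite_measure_subalgebra.intro
        finite_measure_axioms finite_measure_subalgebra_axioms.intro G)
  note B[measurable]
  have "AE \<omega> in M. real_cond_exp M G (\<lambda>\<omega>. 1 - indicator B \<omega>) \<omega> =
      real_cond_exp M G (\<lambda>_. 1) \<omega> - real_cond_exp M G (indicator B) \<omega>"
    by (intro S.real_cond_exp_diff) (auto intro!: integrable_real_indicator simp: less_top[symmetric])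
  moreover have "AE \<omega> in M. real_cond_exp M G (\<lambda>_. 1) \<omega> = 1"
    by (intro S.real_cond_exp_F_meas) auto
  moreover have "AE \<omega> in M. real_cond_exp M G (indicator (space M - B)) \<omega> =
      real_cond_exp M G (\<lambda>\<omega>. 1 - indicator B \<omega>) \<omega>"
    by (intro S.real_cond_exp_cong) (auto simp: indicator_def)
  ultimately show ?thesis unfolding cprob_def by eventually_elim simp
qed

text \<open>In the applications \<open>w\<close> is the indicator of an event; \<open>k\<close> is then a conditional density of \<open>Z\<close>,
  restricted to that event, with respect to \<open>\<nu>\<close>.\<close>

lemma (in finite_measure) nn_integral_disintegration:
  assumes G: "subalgebra M G" and "sigma_finite_measure \<nu>"
    and Z[measurable]: "Z \<in> measurable M \<nu>" and w[measurable]: "w \<in> borel_measurable M"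
    and k: "k \<in> borel_measurable (G \<Otimes>\<^sub>M \<nu>)"
    and fin: "(\<integral>\<^sup>+\<omega>. w \<omega> \<partial>M) < \<infinity>"
    and eq: "\<And>A B. A \<in> sets G \<Longrightarrow> B \<in> sets \<nu> \<Longrightarrow>
      (\<integral>\<^sup>+\<omega>. indicator A \<omega> * indicator B (Z \<omega>) * w \<omega> \<partial>M) =
      (\<integral>\<^sup>+\<omega>. indicator A \<omega> * (\<integral>\<^sup>+z. indicator B z * k (\<omega>, z) \<partial>\<nu>) \<partial>M)"
    and F: "F \<in> borel_measurable (G \<Otimes>\<^sub>M \<nu>)"
  shows "(\<integral>\<^sup>+\<omega>. F (\<omega>, Z \<omega>) * w \<omega> \<partial>M) = (\<integral>\<^sup>+\<omega>. (\<integral>\<^sup>+z. F (\<omega>, z) * k (\<omega>, z) \<partial>\<nu>) \<partial>M)"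
proof -
  interpret \<nu>: sigma_finite_measure \<nu> by fact
  define R where "R = restr_to_subalg M G"
  have sR[measurable_cong]: "sets R = sets G"
    unfolding R_def by (rule sets_restr_to_subalg[OF G])
  have spR: "space R = space M" by (simp add: R_def space_restr_to_subalg)
  have spG: "space G = space M" using G by (simp add: subalgebra_def)
  have id[measurable]: "(\<lambda>x. x) \<in> measurable M G"
    using measurable_from_subalg[OF G, of "\<lambda>x. x" G] by simp
  note k[measurable] F[measurable]
  have kR[measurable]: "k \<in> borel_measurable (R \<Otimes>\<^sub>M \<nu>)" and FR[measurable]: "F \<in> borel_measurable (R \<Otimes>\<^sub>M \<nu>)"
    by measurable
  have RM: "(\<integral>\<^sup>+x. h x \<partial>R) = (\<integral>\<^sup>+x. h x \<partial>M)" if "h \<in> borel_measurable G" for h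
    unfolding R_def by (rule nn_integral_subalgebra2[OF G that])
  define P where "P = distr (density M w) (G \<Otimes>\<^sub>M \<nu>) (\<lambda>\<omega>. (\<omega>, Z \<omega>))"
  define Q where "Q = density (R \<Otimes>\<^sub>M \<nu>) k"
  have emP: "emeasure P (A \<times> B) = (\<integral>\<^sup>+\<omega>. indicator A \<omega> * indicator B (Z \<omega>) * w \<omega> \<partial>M)"
    if [measurable]: "A \<in> sets G" "B \<in> sets \<nu>" for A B
  proof -
    have [measurable]: "A \<in> sets M" using that G by (auto simp: subalgebra_def)
    have *: "(\<lambda>\<omega>. (\<omega>, Z \<omega>)) -` (A \<times> B) \<inter> space M = A \<inter> (Z -` B \<inter> space M)"
      using sets.sets_into_space[OF that(1)] spG by auto
    show ?thesis unfolding P_def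
      by (subst emeasure_distr, measurable)
         (auto simp: emeasure_density * indicator_def ac_simps intro!: nn_integral_cong)
  qed
  have emQ: "emeasure Q (A \<times> B) = (\<integral>\<^sup>+\<omega>. indicator A \<omega> * (\<integral>\<^sup>+z. indicator B z * k (\<omega>, z) \<partial>\<nu>) \<partial>M)"
    if [measurable]: "A \<in> sets G" "B \<in> sets \<nu>" for A B
  proof -
    have "emeasure Q (A \<times> B) = (\<integral>\<^sup>+x. (k x * indicator (A \<times> B) x) \<partial>(R \<Otimes>\<^sub>M \<nu>))"
      unfolding Q_def by (rule emeasure_density) auto
    also have "\<dots> = (\<integral>\<^sup>+\<omega>. (\<integral>\<^sup>+z. k (\<omega>, z) * indicator (A \<times> B) (\<omega>, z) \<partial>\<nu>) \<partial>R)"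
      by (rule \<nu>.nn_integral_fst[symmetric]) auto
    also have "\<dots> = (\<integral>\<^sup>+\<omega>. indicator A \<omega> * (\<integral>\<^sup>+z. indicator B z * k (\<omega>, z) \<partial>\<nu>) \<partial>R)"
      by (intro nn_integral_cong) (auto simp: indicator_def intro!: nn_integral_cong)
    also have "\<dots> = (\<integral>\<^sup>+\<omega>. indicator A \<omega> * (\<integral>\<^sup>+z. indicator B z * k (\<omega>, z) \<partial>\<nu>) \<partial>M)"
      by (rule RM) measurable
    finally show ?thesis .
  qed
  have PQ: "P = Q"
  proof (rule measure_eqI_generator_eq)
    let ?E = "{a \<times> b | a b. a \<in> sets G \<and> b \<in> sets \<nu>}"
    show "Int_stable ?E" by (rule Int_stable_pair_measure_generator)
    show "?E \<subseteq> Pow (space G \<times> space \<nu>)" by (rule pair_measure_closed)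
    show "sets P = sigma_sets (space G \<times> space \<nu>) ?E"
      by (simp add: P_def sets_pair_measure)
    show "sets Q = sigma_sets (space G \<times> space \<nu>) ?E"
      using sets_pair_measure_cong[OF sR refl[of "sets \<nu>"]] by (simp add: Q_def sets_pair_measure)
    show "range (\<lambda>_::nat. space G \<times> space \<nu>) \<subseteq> ?E" by auto
    show "(\<Union>i::nat. space G \<times> space \<nu>) = space G \<times> space \<nu>" by simp
    show "emeasure P (space G \<times> space \<nu>) \<noteq> \<infinity>"
    proof -
      have "emeasure P (space G \<times> space \<nu>) \<le> (\<integral>\<^sup>+\<omega>. w \<omega> \<partial>M)"
        by (subst emP) (auto intro!: nn_integral_mono simp: indicator_def)
      then show ?thesis using fin by auto
    qed
    show "emeasure P X = emeasure Q X" if "X \<in> ?E" for X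
      using that by (auto simp: emP emQ eq)
  qed
  have "(\<integral>\<^sup>+\<omega>. F (\<omega>, Z \<omega>) * w \<omega> \<partial>M) = (\<integral>\<^sup>+x. F x \<partial>P)"
    unfolding P_def by (subst nn_integral_distr) (auto simp: nn_integral_density mult.commute)
  also have "\<dots> = (\<integral>\<^sup>+x. k x * F x \<partial>(R \<Otimes>\<^sub>M \<nu>))"
    unfolding PQ Q_def by (rule nn_integral_density) auto
  also have "\<dots> = (\<integral>\<^sup>+\<omega>. (\<integral>\<^sup>+z. k (\<omega>, z) * F (\<omega>, z) \<partial>\<nu>) \<partial>R)"
    by (rule \<nu>.nn_integral_fst[symmetric]) auto
  also have "\<dots> = (\<integral>\<^sup>+\<omega>. (\<integral>\<^sup>+z. k (\<omega>, z) * F (\<omega>, z) \<partial>\<nu>) \<partial>M)"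
    by (rule RM) measurable
  finally show ?thesis by (simp add: mult.commute)
qed


section \<open>Measurability of the likelihoods\<close>

text \<open>The joint density of the observations and of the event that the latent state is \<open>i\<close>;
  unlike the odds, this recursion involves no division.\<close>

primrec state_likelihood ::
  "('h \<Rightarrow> real) \<Rightarrow> (nat \<Rightarrow> 'h \<Rightarrow> (nat \<Rightarrow> nat) \<Rightarrow> real) \<Rightarrow>
   (nat \<Rightarrow> 'h \<Rightarrow> 'y \<Rightarrow> real) \<Rightarrow> (nat \<Rightarrow> 'h \<Rightarrow> 'y \<Rightarrow> real) \<Rightarrow> (nat \<Rightarrow> 'w \<Rightarrow> nat) \<Rightarrow> (nat \<Rightarrow> 'w \<Rightarrow> 'y) \<Rightarrow>
   nat \<Rightarrow> nat \<Rightarrow> 'w \<Rightarrow> 'h \<Rightarrow> real" where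
  "state_likelihood p\<^sub>0 p f g X Y 0 i \<omega> h = (if i = 0 then 1 - p\<^sub>0 h else p\<^sub>0 h)"
| "state_likelihood p\<^sub>0 p f g X Y (Suc t) i \<omega> h =
     (if i = 0 then state_likelihood p\<^sub>0 p f g X Y t 0 \<omega> h * (1 - hazard p X (Suc t) h \<omega>)
      else state_likelihood p\<^sub>0 p f g X Y t 1 \<omega> h +
        state_likelihood p\<^sub>0 p f g X Y t 0 \<omega> h * hazard p X (Suc t) h \<omega>) *
     (if i = 0 then f (X (Suc t) \<omega>) h (Y (Suc t) \<omega>) else g (X (Suc t) \<omega>) h (Y (Suc t) \<omega>))"

context change_point_model
begin

abbreviation obs :: "nat \<Rightarrow> 'w measure" where
  "obs t \<equiv> obs_algebra M X Y t"

abbreviation lik :: "nat \<Rightarrow> nat \<Rightarrow> 'w \<Rightarrow> 'h \<Rightarrow> real" where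
  "lik \<equiv> state_likelihood p\<^sub>0 p f g X Y"

definition predicted :: "nat \<Rightarrow> nat \<Rightarrow> 'w \<Rightarrow> 'h \<Rightarrow> real" where
  "predicted t i \<omega> h =
     (if i = 0 then lik t 0 \<omega> h * (1 - hazard p X (Suc t) h \<omega>)
      else lik t 1 \<omega> h + lik t 0 \<omega> h * hazard p X (Suc t) h \<omega>)"

definition response :: "nat \<Rightarrow> nat \<Rightarrow> 'w \<Rightarrow> 'h \<Rightarrow> 'y \<Rightarrow> real" where
  "response t i \<omega> h y = (if i = 0 then f (X (Suc t) \<omega>) h y else g (X (Suc t) \<omega>) h y)"

definition evidence :: "nat \<Rightarrow> 'w \<Rightarrow> ennreal" where
  "evidence t \<omega> = (\<integral>\<^sup>+h. ennreal (lik t 0 \<omega> h) + ennreal (lik t 1 \<omega> h) \<partial>prior)"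

declare state_likelihood.simps(2)[simp del]

lemma lik_Suc: "lik (Suc t) i \<omega> h = predicted t i \<omega> h * response t i \<omega> h (Y (Suc t) \<omega>)"
  by (simp add: state_likelihood.simps(2) predicted_def response_def)

lemma sets_prior[measurable_cong]: "sets prior = sets borel"
  using eta_law by (metis sets_distr)

lemma space_prior[simp]: "space prior = UNIV"
  using sets_eq_imp_space_eq[OF sets_prior] by simp

declare mu_sets[measurable_cong]

lemma space_mu[simp]: "space \<mu> = UNIV"
  using sets_eq_imp_space_eq[OF mu_sets] by simp

sublocale prior: prob_space prior
  using prob_space_distr[OF eta_measurable] eta_law by simp

sublocale mu: sigma_finite_measure \<mu>
  by (rule mu_sigma_finite)

sublocale pair: pair_sigma_finite prior \<mu> ..

lemma obs_preimages_subset_Pow: "obs_preimages M X Y t \<subseteq> Pow (space M)"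
  by (auto simp: obs_preimages_def preimages_def)

lemma space_obs[simp]: "space (obs t) = space M"
  by (simp add: obs_algebra_def space_measure_of_conv)

lemma sets_obs: "sets (obs t) = sigma_sets (space M) (obs_preimages M X Y t)"
  by (simp add: obs_algebra_def obs_preimages_subset_Pow)

lemma X_obs: "s \<in> {1..t} \<Longrightarrow> X s \<in> measurable (obs t) (count_space UNIV)"
  unfolding obs_algebra_def
  by (rule measurable_sigma_preimages[OF obs_preimages_subset_Pow]) (auto simp: obs_preimages_def)

lemma Y_obs: "s \<in> {1..t} \<Longrightarrow> Y s \<in> measurable (obs t) borel"
  unfolding obs_algebra_def
  by (rule measurable_sigma_preimages[OF obs_preimages_subset_Pow]) (auto simp: obs_preimages_def)

lemma X_range_obs:
  assumes "s \<in> {1..t}" "\<And>\<omega>. \<omega> \<in> space M \<Longrightarrow> X s \<omega> \<in> {1..K}"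
  shows "X s \<in> measurable (obs t) (count_space {1..K})"
proof -
  have "X s \<in> measurable (obs t) (restrict_space (count_space UNIV) {1..K})"
    by (rule measurable_restrict_space2) (use assms X_obs[of s t] in auto)
  then show ?thesis by (simp add: restrict_count_space)
qed

lemma X_range: "1 \<le> s \<Longrightarrow> \<omega> \<in> space M \<Longrightarrow> X s \<omega> \<in> {1..K}"
proof (induction s arbitrary: \<omega> rule: less_induct)
  case (less s)
  show ?case
  proof (cases "s = 1")
    case True
    then show ?thesis using X_rule less.prems unfolding assignment_rule_def by force
  next
    case False
    then have "2 \<le> s" using less.prems by auto
    then obtain \<phi> where \<phi>: "\<phi> \<in> measurable
         (PiM {1..<s} (\<lambda>_. count_space {1..K}) \<Otimes>\<^sub>M PiM {1..<s} (\<lambda>_. borel :: 'y measure)) (count_space {1..K})"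
       and X: "X s \<omega> = \<phi> (\<lambda>r\<in>{1..<s}. X r \<omega>, \<lambda>r\<in>{1..<s}. Y r \<omega>)"
      using X_rule less.prems unfolding assignment_rule_def by blast
    have "(\<lambda>r\<in>{1..<s}. X r \<omega>, \<lambda>r\<in>{1..<s}. Y r \<omega>) \<in> space
         (PiM {1..<s} (\<lambda>_. count_space {1..K}) \<Otimes>\<^sub>M PiM {1..<s} (\<lambda>_. borel :: 'y measure))"
      using less.IH less.prems by (auto simp: space_pair_measure space_PiM)
    from measurable_space[OF \<phi> this] show ?thesis by (simp add: X)
  qed
qed

lemma X_predictable[measurable]: "X (Suc t) \<in> measurable (obs t) (count_space {1..K})"
proof (cases "t = 0")
  case True
  obtain a where "a \<in> {1..K}" "\<And>\<omega>. \<omega> \<in> space M \<Longrightarrow> X 1 \<omega> = a"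
    using X_rule unfolding assignment_rule_def by blast
  then show ?thesis
    using True by (subst measurable_cong[where g="\<lambda>_. a"]) auto
next
  case False
  then have "2 \<le> Suc t" by auto
  then obtain \<phi> where \<phi>[measurable]: "\<phi> \<in> measurable
       (PiM {1..<Suc t} (\<lambda>_. count_space {1..K}) \<Otimes>\<^sub>M PiM {1..<Suc t} (\<lambda>_. borel :: 'y measure)) (count_space {1..K})"
     and X: "\<And>\<omega>. \<omega> \<in> space M \<Longrightarrow> X (Suc t) \<omega> = \<phi> (\<lambda>r\<in>{1..<Suc t}. X r \<omega>, \<lambda>r\<in>{1..<Suc t}. Y r \<omega>)"
    using X_rule unfolding assignment_rule_def by blast
  have [measurable]: "(\<lambda>\<omega>. \<lambda>r\<in>{1..<Suc t}. X r \<omega>) \<in> measurable (obs t) (PiM {1..<Suc t} (\<lambda>_. count_space {1..K}))"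
    by (rule measurable_restrict) (use X_range in \<open>auto intro!: X_range_obs simp del: One_nat_def\<close>)
  have [measurable]: "(\<lambda>\<omega>. \<lambda>r\<in>{1..<Suc t}. Y r \<omega>) \<in> measurable (obs t) (PiM {1..<Suc t} (\<lambda>_. borel))"
    by (rule measurable_restrict) (auto intro: Y_obs)
  show ?thesis
    by (subst measurable_cong[OF X], simp) (rule measurable_compose[OF _ \<phi>], measurable)
qed

lemma X_predictable_UNIV: "X (Suc t) \<in> measurable (obs t) (count_space UNIV)"
  by (rule measurable_compose[OF X_predictable]) auto

lemma obs_subset: "sets (obs t) \<subseteq> sets M"
proof (induction t)
  case 0
  show ?case by (simp add: sets_obs obs_preimages_def sigma_sets_empty_eq)
next
  case (Suc t)
  have sub: "subalgebra M (obs t)" using Suc by (simp add: subalgebra_def)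
  have "preimages M (X (Suc t)) (count_space UNIV) \<subseteq> sets M"
    by (rule preimages_subset_sets[OF refl measurable_from_subalg[OF sub X_predictable_UNIV]])
  moreover have "preimages M (Y (Suc t)) borel \<subseteq> sets M"
    by (rule preimages_subset_sets[OF refl Y_measurable]) simp
  moreover have "obs_preimages M X Y t \<subseteq> sets M"
    using Suc by (auto simp: sets_obs)
  moreover have "obs_preimages M X Y (Suc t) = obs_preimages M X Y t \<union>
      (preimages M (X (Suc t)) (count_space UNIV) \<union> preimages M (Y (Suc t)) borel)"
    by (auto simp: obs_preimages_def atLeastAtMostSuc_conv)
  ultimately have "obs_preimages M X Y (Suc t) \<subseteq> sets M" by simp
  then show ?case unfolding obs_algebra_def by (rule sigma_subset_sets[OF refl])
qed

lemma subalgebra_obs: "subalgebra M (obs t)"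
  by (simp add: subalgebra_def obs_subset)

lemma hazard_measurable[measurable]:
  "(\<lambda>(\<omega>, h). hazard p X (Suc t) h \<omega>) \<in> borel_measurable (obs t \<Otimes>\<^sub>M borel)"
proof -
  let ?I = "PiE {1..Suc t} (\<lambda>_. {1..K})"
  have fin: "finite ?I" by (intro finite_PiE) auto
  have Xm: "X s \<in> measurable (obs t) (count_space {1..K})" if "s \<in> {1..Suc t}" for s
    using that X_range_obs[of s t, OF _ X_range] X_predictable by (cases "s = Suc t") auto
  have "(\<lambda>\<omega>. \<lambda>s\<in>{1..Suc t}. X s \<omega>) \<in> measurable (obs t) (PiM {1..Suc t} (\<lambda>_. count_space {1..K}))"
    by (rule measurable_restrict) (use Xm in auto)
  also have "PiM {1..Suc t} (\<lambda>_. count_space {1..K}) = count_space ?I"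
    by (rule count_space_PiM_finite) auto
  finally have [measurable]: "(\<lambda>\<omega>. \<lambda>s\<in>{1..Suc t}. X s \<omega>) \<in> measurable (obs t) (count_space ?I)" .
  have 1: "(\<lambda>z. p (Suc t) (snd z) x) \<in> borel_measurable (obs t \<Otimes>\<^sub>M borel)" if "x \<in> ?I" for x
    using p_measurable[OF _ that] by measurable
  have 2: "(\<lambda>z. \<lambda>s\<in>{1..Suc t}. X s (fst z)) \<in> measurable (obs t \<Otimes>\<^sub>M borel) (count_space ?I)"
    by measurable
  have "(\<lambda>z. p (Suc t) (snd z) (\<lambda>s\<in>{1..Suc t}. X s (fst z))) \<in> borel_measurable (obs t \<Otimes>\<^sub>M (borel :: 'h measure))"
    by (rule measurable_compose_countable'[of ?I "\<lambda>x z. p (Suc t) (snd z) x", OF 1 2 countable_finite[OF fin]])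
  then show ?thesis by (simp add: hazard_def case_prod_beta)
qed

lemma hazard_compose[measurable (raw)]:
  assumes "a \<in> measurable N (obs t)" "b \<in> measurable N borel"
  shows "(\<lambda>z. hazard p X (Suc t) (b z) (a z)) \<in> borel_measurable N"
  using measurable_compose[OF measurable_Pair[OF assms] hazard_measurable] by simp

lemma hazard_range: "\<omega> \<in> space M \<Longrightarrow> 0 \<le> hazard p X (Suc t) h \<omega> \<and> hazard p X (Suc t) h \<omega> < 1"
  unfolding hazard_def by (rule p_range) (use X_range[of _ \<omega>] in auto)

lemma response_measurable[measurable]:
  "(\<lambda>(\<omega>, h, y). response t i \<omega> h y) \<in> borel_measurable (obs t \<Otimes>\<^sub>M borel \<Otimes>\<^sub>M borel)"
proof -
  have Xm: "(\<lambda>z. X (Suc t) (fst z)) \<in> measurable (obs t \<Otimes>\<^sub>M borel \<Otimes>\<^sub>M borel) (count_space {1..K})"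
    by measurable
  have "(\<lambda>z. q (X (Suc t) (fst z)) (fst (snd z)) (snd (snd z)))
      \<in> borel_measurable (obs t \<Otimes>\<^sub>M borel \<Otimes>\<^sub>M borel)"
    if q: "\<And>x. x \<in> {1..K} \<Longrightarrow> (\<lambda>(h, y). q x h y) \<in> borel_measurable (borel \<Otimes>\<^sub>M borel)"
    for q :: "nat \<Rightarrow> 'h \<Rightarrow> 'y \<Rightarrow> real"
  proof (rule measurable_compose_countable'[of "{1..K}" "\<lambda>x z. q x (fst (snd z)) (snd (snd z))", OF _ Xm])
    show "(\<lambda>z. q x (fst (snd z)) (snd (snd z))) \<in> borel_measurable (obs t \<Otimes>\<^sub>M borel \<Otimes>\<^sub>M borel)"
      if "x \<in> {1..K}" for x
      using measurable_compose[OF measurable_snd q[OF that]] by (simp add: case_prod_beta)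
  qed auto
  from this[OF f_measurable] this[OF g_measurable] show ?thesis
    unfolding response_def case_prod_beta by (cases "i = 0") auto
qed

lemma response_compose[measurable (raw)]:
  assumes "a \<in> measurable N (obs t)" "b \<in> measurable N borel" "c \<in> measurable N borel"
  shows "(\<lambda>z. response t i (a z) (b z) (c z)) \<in> borel_measurable N"
  using measurable_compose[OF measurable_Pair[OF assms(1) measurable_Pair[OF assms(2,3)]]
      response_measurable] by simp

lemma response_nonneg: "\<omega> \<in> space M \<Longrightarrow> 0 \<le> response t i \<omega> h y"
  using f_nonneg g_nonneg X_range[of "Suc t" \<omega>] by (auto simp: response_def)

lemma response_density: "\<omega> \<in> space M \<Longrightarrow> (\<integral>\<^sup>+y. ennreal (response t i \<omega> h y) \<partial>\<mu>) = 1"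
  using f_density[OF X_range, of "Suc t" \<omega> h] g_density[OF X_range, of "Suc t" \<omega> h]
  by (cases "i = 0") (simp_all add: response_def)

lemma lik_nonneg: "\<omega> \<in> space M \<Longrightarrow> 0 \<le> lik t i \<omega> h"
proof (induction t arbitrary: i)
  case 0
  then show ?case using p0_range[of h] by simp
next
  case (Suc t)
  then have "0 \<le> predicted t i \<omega> h"
    using hazard_range[of \<omega> t h] by (auto simp: predicted_def intro!: mult_nonneg_nonneg)
  then show ?case
    unfolding lik_Suc using Suc.prems by (intro mult_nonneg_nonneg response_nonneg)
qed

lemma predicted_nonneg: "\<omega> \<in> space M \<Longrightarrow> 0 \<le> predicted t i \<omega> h"
  using hazard_range[of \<omega> t h] lik_nonneg[of \<omega> t]
  by (auto simp: predicted_def intro!: mult_nonneg_nonneg)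

lemma obs_Suc: "sets (obs t) \<subseteq> sets (obs (Suc t))"
  unfolding sets_obs by (rule sigma_sets_mono') (force simp: obs_preimages_def)

lemma predicted_measurable_if:
  assumes [measurable]: "\<And>i. (\<lambda>(\<omega>, h). lik t i \<omega> h) \<in> borel_measurable (obs t \<Otimes>\<^sub>M borel)"
  shows "(\<lambda>(\<omega>, h). predicted t i \<omega> h) \<in> borel_measurable (obs t \<Otimes>\<^sub>M borel)"
  unfolding predicted_def case_prod_beta by measurable

lemma lik_measurable[measurable]: "(\<lambda>(\<omega>, h). lik t i \<omega> h) \<in> borel_measurable (obs t \<Otimes>\<^sub>M borel)"
proof (induction t arbitrary: i)
  case 0
  note p0_measurable[measurable]
  show ?case by (cases "i = 0") auto
next
  case (Suc t)
  have [measurable]: "(\<lambda>\<omega>. \<omega>) \<in> measurable (obs (Suc t)) (obs t)"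
    by (rule measurable_from_subalg[of _ "obs t"]) (simp_all add: subalgebra_def obs_Suc)
  have [measurable]: "(\<lambda>z. predicted t i (fst z) (snd z)) \<in> borel_measurable (obs (Suc t) \<Otimes>\<^sub>M borel)"
    using measurable_compose[OF measurable_Pair predicted_measurable_if[OF Suc],
        of fst "obs (Suc t) \<Otimes>\<^sub>M borel" snd] by simp
  have [measurable]: "Y (Suc t) \<in> measurable (obs (Suc t)) borel" by (rule Y_obs) auto
  show ?case unfolding lik_Suc case_prod_beta by measurable
qed

lemma lik_compose[measurable (raw)]:
  assumes "a \<in> measurable N (obs t)" "b \<in> measurable N borel"
  shows "(\<lambda>z. lik t i (a z) (b z)) \<in> borel_measurable N"
  using measurable_compose[OF measurable_Pair[OF assms] lik_measurable] by simp

lemma predicted_measurable[measurable]: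
  "(\<lambda>(\<omega>, h). predicted t i \<omega> h) \<in> borel_measurable (obs t \<Otimes>\<^sub>M borel)"
  by (rule predicted_measurable_if[OF lik_measurable])

lemma predicted_compose[measurable (raw)]:
  assumes "a \<in> measurable N (obs t)" "b \<in> measurable N borel"
  shows "(\<lambda>z. predicted t i (a z) (b z)) \<in> borel_measurable N"
  using measurable_compose[OF measurable_Pair[OF assms] predicted_measurable] by simp

lemma evidence_measurable[measurable]: "evidence t \<in> borel_measurable (obs t)"
  unfolding evidence_def by measurable

lemma latent_measurable: "latent \<Theta> t \<in> measurable M (count_space UNIV)"
  unfolding latent_def by (rule measurable_compose[OF Theta_measurable]) auto

lemma latent_Suc: "latent \<Theta> t \<omega> = 1 \<Longrightarrow> latent \<Theta> (Suc t) \<omega> = 1"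
  by (auto simp: latent_def not_less split: if_splits intro: order_trans)


section \<open>The model laws in integrated form\<close>

abbreviation in_state :: "nat \<Rightarrow> nat \<Rightarrow> 'w set" where
  "in_state t i \<equiv> {\<omega> \<in> space M. latent \<Theta> t \<omega> = i}"

lemma id_obs[measurable]: "(\<lambda>\<omega>. \<omega>) \<in> measurable M (obs t)"
  by (rule measurable_from_subalg[OF subalgebra_obs[of t]]) simp

lemma in_state_sets[measurable]: "in_state t i \<in> sets M"
  using latent_measurable[of t] by measurable

lemma Y_Suc_measurable[measurable]: "Y (Suc t) \<in> measurable M borel"
  by (rule Y_measurable) simp

declare eta_measurable[measurable]

lemma obs_preimages_sets: "obs_preimages M X Y t \<subseteq> sets M"
  using obs_subset[of t] by (auto simp: sets_obs)

lemma X_Suc_measurable: "X (Suc t) \<in> measurable M (count_space UNIV)"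
  by (rule measurable_from_subalg[OF subalgebra_obs X_predictable_UNIV])

lemma measurable_from_obs:
  assumes "S \<subseteq> Pow (space M)" "obs_preimages M X Y t \<subseteq> S"
  shows "(\<lambda>\<omega>. \<omega>) \<in> measurable (sigma (space M) S) (obs t)"
proof -
  have "sets (obs t) \<subseteq> sets (sigma (space M) S)"
    unfolding obs_algebra_def by (rule sigma_subset_sets) (use assms in auto)
  then have "subalgebra (sigma (space M) S) (obs t)"
    by (simp add: subalgebra_def space_measure_of_conv)
  then show ?thesis by (rule measurable_from_subalg) simp
qed

lemma initial_nn_integral:
  assumes F[measurable]: "F \<in> borel_measurable borel" and i: "i \<in> {0, 1}"
  shows "(\<integral>\<^sup>+\<omega>. F (\<eta> \<omega>) * indicator (in_state 0 i) \<omega> \<partial>M) =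
    (\<integral>\<^sup>+h. F h * ennreal (lik 0 i \<omega>' h) \<partial>prior)"
proof -
  note p0_measurable[measurable]
  define G where "G = sigma (space M) (preimages M \<eta> borel)"
  have sub: "subalgebra M G"
    unfolding G_def by (rule subalgebra_sigma[OF preimages_subset_sets[OF refl eta_measurable]])
  have [measurable]: "\<eta> \<in> measurable G borel"
    unfolding G_def by (rule measurable_sigma_preimages[OF preimages_subset_Pow]) auto
  have law: "AE \<omega> in M. cprob M G (in_state 0 1) \<omega> = p\<^sub>0 (\<eta> \<omega>)"
    using initial_law by (simp add: G_def)
  have "space M - in_state 0 1 = in_state 0 0" by (auto simp: latent_def)
  then have "AE \<omega> in M. cprob M G (in_state 0 0) \<omega> = 1 - cprob M G (in_state 0 1) \<omega>"
    using cprob_compl[OF sub in_state_sets[of 0 1]] by simp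
  with law have law': "AE \<omega> in M. cprob M G (in_state 0 i) \<omega> = lik 0 i \<omega>' (\<eta> \<omega>)"
    by eventually_elim (use i in auto)
  have [measurable]: "lik 0 i \<omega>' \<in> borel_measurable borel"
    by (subst state_likelihood.simps(1)[abs_def]) measurable
  have "(\<integral>\<^sup>+\<omega>. F (\<eta> \<omega>) * indicator (in_state 0 i) \<omega> \<partial>M) =
      (\<integral>\<^sup>+\<omega>. F (\<eta> \<omega>) * ennreal (cprob M G (in_state 0 i) \<omega>) \<partial>M)"
    by (rule cprob_nn_integral[OF sub in_state_sets]) measurable
  also have "\<dots> = (\<integral>\<^sup>+\<omega>. F (\<eta> \<omega>) * ennreal (lik 0 i \<omega>' (\<eta> \<omega>)) \<partial>M)"
    by (rule nn_integral_cong_AE) (use law' in eventually_elim, simp)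
  also have "\<dots> = (\<integral>\<^sup>+h. F h * ennreal (lik 0 i \<omega>' h) \<partial>distr M borel \<eta>)"
    by (rule nn_integral_distr[symmetric]) measurable
  finally show ?thesis by (simp add: eta_law)
qed

lemma transition_nn_integral:
  assumes F[measurable]: "F \<in> borel_measurable (obs t \<Otimes>\<^sub>M borel)" and i: "i \<in> {0, 1}"
  shows "(\<integral>\<^sup>+\<omega>. F (\<omega>, \<eta> \<omega>) * indicator (in_state t 0) \<omega> * indicator (in_state (Suc t) i) \<omega> \<partial>M) =
    (\<integral>\<^sup>+\<omega>. F (\<omega>, \<eta> \<omega>) * indicator (in_state t 0) \<omega> *
      ennreal (if i = 0 then 1 - hazard p X (Suc t) (\<eta> \<omega>) \<omega> else hazard p X (Suc t) (\<eta> \<omega>) \<omega>) \<partial>M)"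
proof -
  define S where "S = preimages M \<eta> borel \<union> preimages M (latent \<Theta> t) (count_space UNIV) \<union>
               obs_preimages M X Y t \<union> preimages M (X (Suc t)) (count_space UNIV)"
  define G where "G = sigma (space M) S"
  have S: "S \<subseteq> sets M"
    unfolding S_def
    by (intro Un_least preimages_subset_sets[OF refl] eta_measurable latent_measurable
        obs_preimages_sets X_Suc_measurable)
  have SP: "S \<subseteq> Pow (space M)" using S sets.sets_into_space by blast
  have sub: "subalgebra M G" unfolding G_def by (rule subalgebra_sigma[OF S])
  have [measurable]: "\<eta> \<in> measurable G borel" "latent \<Theta> t \<in> measurable G (count_space UNIV)"
    "(\<lambda>\<omega>. \<omega>) \<in> measurable G (obs t)"
    unfolding G_def
    by (rule measurable_sigma_preimages[OF SP] measurable_from_obs[OF SP]; force simp: S_def)+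
  have sG: "space G = space M" by (simp add: G_def space_measure_of_conv)
  have [measurable]: "in_state t 0 \<in> sets G"
    unfolding sG[symmetric] by measurable
  have law: "AE \<omega> in M. latent \<Theta> t \<omega> = 0 \<longrightarrow>
      cprob M G (in_state (Suc t) 1) \<omega> = hazard p X (Suc t) (\<eta> \<omega>) \<omega>"
    using transition_law[of "Suc t"] by (simp add: G_def S_def)
  have "space M - in_state (Suc t) 1 = in_state (Suc t) 0" by (auto simp: latent_def)
  then have "AE \<omega> in M. cprob M G (in_state (Suc t) 0) \<omega> = 1 - cprob M G (in_state (Suc t) 1) \<omega>"
    using cprob_compl[OF sub in_state_sets[of "Suc t" 1]] by simp
  with law have law': "AE \<omega> in M. latent \<Theta> t \<omega> = 0 \<longrightarrow> cprob M G (in_state (Suc t) i) \<omega> =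
      (if i = 0 then 1 - hazard p X (Suc t) (\<eta> \<omega>) \<omega> else hazard p X (Suc t) (\<eta> \<omega>) \<omega>)"
    by eventually_elim (use i in auto)
  have "(\<integral>\<^sup>+\<omega>. F (\<omega>, \<eta> \<omega>) * indicator (in_state t 0) \<omega> * indicator (in_state (Suc t) i) \<omega> \<partial>M) =
      (\<integral>\<^sup>+\<omega>. F (\<omega>, \<eta> \<omega>) * indicator (in_state t 0) \<omega> * ennreal (cprob M G (in_state (Suc t) i) \<omega>) \<partial>M)"
    by (rule cprob_nn_integral[OF sub in_state_sets]) measurable
  also have "\<dots> = (\<integral>\<^sup>+\<omega>. F (\<omega>, \<eta> \<omega>) * indicator (in_state t 0) \<omega> *
      ennreal (if i = 0 then 1 - hazard p X (Suc t) (\<eta> \<omega>) \<omega> else hazard p X (Suc t) (\<eta> \<omega>) \<omega>) \<partial>M)"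
    by (rule nn_integral_cong_AE) (use law' in eventually_elim, use i in \<open>auto simp: indicator_def\<close>)
  finally show ?thesis .
qed

lemma response_nn_integral:
  assumes F[measurable]: "F \<in> borel_measurable (obs t \<Otimes>\<^sub>M borel \<Otimes>\<^sub>M borel)" and i: "i \<in> {0, 1}"
  shows "(\<integral>\<^sup>+\<omega>. F (\<omega>, \<eta> \<omega>, Y (Suc t) \<omega>) * indicator (in_state (Suc t) i) \<omega> \<partial>M) =
    (\<integral>\<^sup>+\<omega>. (\<integral>\<^sup>+y. F (\<omega>, \<eta> \<omega>, y) * ennreal (response t i \<omega> (\<eta> \<omega>) y) \<partial>\<mu>) *
      indicator (in_state (Suc t) i) \<omega> \<partial>M)"
proof -
  define S where "S = preimages M \<eta> borel \<union>
     (\<Union>s\<in>{0..Suc t}. preimages M (latent \<Theta> s) (count_space UNIV)) \<union>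
     obs_preimages M X Y t \<union> preimages M (X (Suc t)) (count_space UNIV)"
  define G where "G = sigma (space M) S"
  have S: "S \<subseteq> sets M"
    unfolding S_def
    by (intro Un_least UN_least preimages_subset_sets[OF refl] eta_measurable latent_measurable
        obs_preimages_sets X_Suc_measurable)
  have SP: "S \<subseteq> Pow (space M)" using S sets.sets_into_space by blast
  have sub: "subalgebra M G" unfolding G_def by (rule subalgebra_sigma[OF S])
  have [measurable]: "\<eta> \<in> measurable G borel" "latent \<Theta> (Suc t) \<in> measurable G (count_space UNIV)"
    "(\<lambda>\<omega>. \<omega>) \<in> measurable G (obs t)"
    unfolding G_def
    by (rule measurable_sigma_preimages[OF SP] measurable_from_obs[OF SP]; force simp: S_def)+
  have sG: "space G = space M" by (simp add: G_def space_measure_of_conv)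
  have [measurable]: "in_state (Suc t) i \<in> sets G"
    unfolding sG[symmetric] by measurable
  define k where "k = (\<lambda>(\<omega>, y). response t (latent \<Theta> (Suc t) \<omega>) \<omega> (\<eta> \<omega>) y)"
  have k_if: "k = (\<lambda>z. if latent \<Theta> (Suc t) (fst z) = 0 then response t 0 (fst z) (\<eta> (fst z)) (snd z)
      else response t 1 (fst z) (\<eta> (fst z)) (snd z))"
    by (auto simp: k_def response_def fun_eq_iff)
  have k[measurable]: "k \<in> borel_measurable (G \<Otimes>\<^sub>M borel)"
    unfolding k_if by (intro measurable_If) measurable
  have k_nonneg: "0 \<le> k (\<omega>, y)" if "\<omega> \<in> space M" for \<omega> y
    using response_nonneg[OF that] by (simp add: k_def)
  have law: "AE \<omega> in M. cprob M G {\<omega> \<in> space M. Y (Suc t) \<omega> \<in> B} \<omega> = (LINT y:B|\<mu>. k (\<omega>, y))"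
    if "B \<in> sets borel" for B
    using response_law[OF _ that, of "Suc t"] by (simp add: G_def S_def k_def response_def)
  have kint: "ennreal (LINT y:B|\<mu>. k (\<omega>, y)) = (\<integral>\<^sup>+y. indicator B y * ennreal (k (\<omega>, y)) \<partial>\<mu>)"
    if \<omega>: "\<omega> \<in> space M" and [measurable]: "B \<in> sets borel" for B \<omega>
  proof -
    have [measurable]: "(\<lambda>y. k (\<omega>, y)) \<in> borel_measurable borel"
      using measurable_compose[OF measurable_Pair1' k] \<omega> sG by simp
    have "(LINT y:B|\<mu>. k (\<omega>, y)) = enn2real (\<integral>\<^sup>+y. ennreal (indicator B y *\<^sub>R k (\<omega>, y)) \<partial>\<mu>)"
      unfolding set_lebesgue_integral_def
      by (rule integral_eq_nn_integral) (auto simp: k_nonneg[OF \<omega>])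
    also have "(\<integral>\<^sup>+y. ennreal (indicator B y *\<^sub>R k (\<omega>, y)) \<partial>\<mu>) =
        (\<integral>\<^sup>+y. indicator B y * ennreal (k (\<omega>, y)) \<partial>\<mu>)"
      by (intro nn_integral_cong) (auto simp: indicator_def)
    finally have eq: "(LINT y:B|\<mu>. k (\<omega>, y)) = enn2real (\<integral>\<^sup>+y. indicator B y * ennreal (k (\<omega>, y)) \<partial>\<mu>)" .
    have "(\<integral>\<^sup>+y. indicator B y * ennreal (k (\<omega>, y)) \<partial>\<mu>) \<le> (\<integral>\<^sup>+y. ennreal (k (\<omega>, y)) \<partial>\<mu>)"
      by (intro nn_integral_mono) (auto simp: indicator_def)
    also have "\<dots> = 1" using response_density[OF \<omega>] by (simp add: k_def)
    finally have "(\<integral>\<^sup>+y. indicator B y * ennreal (k (\<omega>, y)) \<partial>\<mu>) < \<top>"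
      by (rule le_less_trans) simp
    then show ?thesis unfolding eq by simp
  qed
  let ?F = "\<lambda>(\<omega>, y). F (\<omega>, \<eta> \<omega>, y) * indicator (in_state (Suc t) i) \<omega>"
  have "(\<integral>\<^sup>+\<omega>. ?F (\<omega>, Y (Suc t) \<omega>) * 1 \<partial>M) =
     (\<integral>\<^sup>+\<omega>. (\<integral>\<^sup>+y. ?F (\<omega>, y) * ennreal (k (\<omega>, y)) \<partial>\<mu>) \<partial>M)"
  proof (rule nn_integral_disintegration[OF sub mu_sigma_finite])
    show "?F \<in> borel_measurable (G \<Otimes>\<^sub>M \<mu>)"
      by measurable
    show "(\<integral>\<^sup>+\<omega>. 1 \<partial>M) < \<infinity>" by (simp add: emeasure_space_1)
    fix A B assume A[measurable]: "A \<in> sets G" and "B \<in> sets \<mu>"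
    then have B[measurable]: "B \<in> sets borel" by (simp add: mu_sets)
    have "(\<integral>\<^sup>+\<omega>. indicator A \<omega> * indicator B (Y (Suc t) \<omega>) \<partial>M) =
        (\<integral>\<^sup>+\<omega>. indicator A \<omega> * indicator {\<omega> \<in> space M. Y (Suc t) \<omega> \<in> B} \<omega> \<partial>M)"
      by (intro nn_integral_cong) (auto simp: indicator_def)
    also have "\<dots> = (\<integral>\<^sup>+\<omega>. indicator A \<omega> * ennreal (cprob M G {\<omega> \<in> space M. Y (Suc t) \<omega> \<in> B} \<omega>) \<partial>M)"
      by (rule cprob_nn_integral[OF sub]) measurable
    also have "\<dots> = (\<integral>\<^sup>+\<omega>. indicator A \<omega> * (\<integral>\<^sup>+y. indicator B y * ennreal (k (\<omega>, y)) \<partial>\<mu>) \<partial>M)"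
      by (rule nn_integral_cong_AE) (use law[OF B] AE_space in eventually_elim, simp add: kint)
    finally show "(\<integral>\<^sup>+\<omega>. indicator A \<omega> * indicator B (Y (Suc t) \<omega>) * 1 \<partial>M) =
        (\<integral>\<^sup>+\<omega>. indicator A \<omega> * (\<integral>\<^sup>+y. indicator B y * ennreal (k (\<omega>, y)) \<partial>\<mu>) \<partial>M)" by simp
  qed measurable
  also have "\<dots> = (\<integral>\<^sup>+\<omega>. (\<integral>\<^sup>+y. F (\<omega>, \<eta> \<omega>, y) * ennreal (response t i \<omega> (\<eta> \<omega>) y) \<partial>\<mu>) *
      indicator (in_state (Suc t) i) \<omega> \<partial>M)"
    by (intro nn_integral_cong) (auto simp: indicator_def k_def)
  finally show ?thesis by simp
qed


section \<open>Bayes' formula for the parameter and the latent state\<close>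

definition filter_formula :: "nat \<Rightarrow> bool" where
  "filter_formula t \<longleftrightarrow>
     (AE \<omega> in M. evidence t \<omega> \<noteq> 0 \<and> evidence t \<omega> \<noteq> \<top>) \<and>
     (\<forall>i\<in>{0, 1}. \<forall>F \<in> borel_measurable (obs t \<Otimes>\<^sub>M borel).
       (\<integral>\<^sup>+\<omega>. F (\<omega>, \<eta> \<omega>) * indicator (in_state t i) \<omega> \<partial>M) =
       (\<integral>\<^sup>+\<omega>. (\<integral>\<^sup>+h. F (\<omega>, h) * (ennreal (lik t i \<omega> h) * inverse (evidence t \<omega>)) \<partial>prior) \<partial>M))"

lemma filter_formulaI:
  assumes "AE \<omega> in M. evidence t \<omega> \<noteq> 0 \<and> evidence t \<omega> \<noteq> \<top>"
    and rect: "\<And>i A C. i \<in> {0, 1} \<Longrightarrow> A \<in> sets (obs t) \<Longrightarrow> C \<in> sets borel \<Longrightarrow>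
      (\<integral>\<^sup>+\<omega>. indicator A \<omega> * indicator C (\<eta> \<omega>) * indicator (in_state t i) \<omega> \<partial>M) =
      (\<integral>\<^sup>+\<omega>. indicator A \<omega> * (\<integral>\<^sup>+h. indicator C h *
        (ennreal (lik t i \<omega> h) * inverse (evidence t \<omega>)) \<partial>prior) \<partial>M)"
  shows "filter_formula t"
  unfolding filter_formula_def
proof (intro conjI ballI)
  fix i :: nat and F :: "'w \<times> 'h \<Rightarrow> ennreal"
  assume i: "i \<in> {0, 1}" and F[measurable]: "F \<in> borel_measurable (obs t \<Otimes>\<^sub>M borel)"
  have "(\<integral>\<^sup>+\<omega>. F (\<omega>, \<eta> \<omega>) * indicator (in_state t i) \<omega> \<partial>M) =
       (\<integral>\<^sup>+\<omega>. (\<integral>\<^sup>+h. F (\<omega>, h) * (\<lambda>(\<omega>, h). ennreal (lik t i \<omega> h) * inverse (evidence t \<omega>)) (\<omega>, h) \<partial>prior) \<partial>M)"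
  proof (rule nn_integral_disintegration[OF subalgebra_obs prior.sigma_finite_measure])
    have "(\<integral>\<^sup>+\<omega>. indicator (in_state t i) \<omega> \<partial>M) = emeasure M (in_state t i)"
      by (rule nn_integral_indicator) measurable
    then show "(\<integral>\<^sup>+\<omega>. indicator (in_state t i) \<omega> \<partial>M) < \<infinity>"
      by (simp add: less_top[symmetric])
    show "(\<integral>\<^sup>+\<omega>. indicator A \<omega> * indicator C (\<eta> \<omega>) * indicator (in_state t i) \<omega> \<partial>M) =
      (\<integral>\<^sup>+\<omega>. indicator A \<omega> * (\<integral>\<^sup>+h. indicator C h *
        (\<lambda>(\<omega>, h). ennreal (lik t i \<omega> h) * inverse (evidence t \<omega>)) (\<omega>, h) \<partial>prior) \<partial>M)"
      if "A \<in> sets (obs t)" "C \<in> sets prior" for A C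
      using rect[OF i that(1), of C] that(2) by (simp add: sets_prior)
  qed measurable
  then show "(\<integral>\<^sup>+\<omega>. F (\<omega>, \<eta> \<omega>) * indicator (in_state t i) \<omega> \<partial>M) =
       (\<integral>\<^sup>+\<omega>. (\<integral>\<^sup>+h. F (\<omega>, h) * (ennreal (lik t i \<omega> h) * inverse (evidence t \<omega>)) \<partial>prior) \<partial>M)"
    by simp
qed fact

lemma filter_formulaD:
  assumes "filter_formula t" "i \<in> {0, 1}" "F \<in> borel_measurable (obs t \<Otimes>\<^sub>M borel)"
  shows "(\<integral>\<^sup>+\<omega>. F (\<omega>, \<eta> \<omega>) * indicator (in_state t i) \<omega> \<partial>M) =
       (\<integral>\<^sup>+\<omega>. (\<integral>\<^sup>+h. F (\<omega>, h) * (ennreal (lik t i \<omega> h) * inverse (evidence t \<omega>)) \<partial>prior) \<partial>M)"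
  using assms unfolding filter_formula_def by blast

lemma filter_formula_0: "filter_formula 0"
proof (rule filter_formulaI)
  have ev: "evidence 0 \<omega> = 1" for \<omega>
  proof -
    have "ennreal (lik 0 0 \<omega> h) + ennreal (lik 0 1 \<omega> h) = 1" for h
      using p0_range[of h] by (simp flip: ennreal_plus)
    then show ?thesis using prior.emeasure_space_1 by (simp add: evidence_def)
  qed
  show "AE \<omega> in M. evidence 0 \<omega> \<noteq> 0 \<and> evidence 0 \<omega> \<noteq> \<top>" by (simp add: ev)
  fix i :: nat and A :: "'w set" and C :: "'h set"
  assume i: "i \<in> {0, 1}" and A: "A \<in> sets (obs 0)" and C[measurable]: "C \<in> sets borel"
  have "A = {} \<or> A = space M"
    using A by (simp add: sets_obs obs_preimages_def sigma_sets_empty_eq)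
  then show "(\<integral>\<^sup>+\<omega>. indicator A \<omega> * indicator C (\<eta> \<omega>) * indicator (in_state 0 i) \<omega> \<partial>M) =
      (\<integral>\<^sup>+\<omega>. indicator A \<omega> * (\<integral>\<^sup>+h. indicator C h *
        (ennreal (lik 0 i \<omega> h) * inverse (evidence 0 \<omega>)) \<partial>prior) \<partial>M)"
  proof
    assume A: "A = space M"
    obtain \<omega>' where "\<omega>' \<in> space M" using not_empty by blast
    have "(\<integral>\<^sup>+\<omega>. indicator A \<omega> * indicator C (\<eta> \<omega>) * indicator (in_state 0 i) \<omega> \<partial>M) =
        (\<integral>\<^sup>+\<omega>. indicator C (\<eta> \<omega>) * indicator (in_state 0 i) \<omega> \<partial>M)"
      by (intro nn_integral_cong) (simp add: A)
    also have "\<dots> = (\<integral>\<^sup>+h. indicator C h * ennreal (lik 0 i \<omega>' h) \<partial>prior)"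
      by (rule initial_nn_integral[OF _ i]) measurable
    also have "\<dots> = (\<integral>\<^sup>+\<omega>. (\<integral>\<^sup>+h. indicator C h * ennreal (lik 0 i \<omega>' h) \<partial>prior) \<partial>M)"
      by (simp add: emeasure_space_1)
    also have "\<dots> = (\<integral>\<^sup>+\<omega>. indicator A \<omega> * (\<integral>\<^sup>+h. indicator C h *
        (ennreal (lik 0 i \<omega> h) * inverse (evidence 0 \<omega>)) \<partial>prior) \<partial>M)"
      by (intro nn_integral_cong) (simp add: A ev)
    finally show ?thesis .
  qed simp
qed

lemma predicted_nn_integral:
  assumes ff: "filter_formula t" and i: "i \<in> {0, 1}"
    and F[measurable]: "F \<in> borel_measurable (obs t \<Otimes>\<^sub>M borel)"
  shows "(\<integral>\<^sup>+\<omega>. F (\<omega>, \<eta> \<omega>) * indicator (in_state (Suc t) i) \<omega> \<partial>M) =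
    (\<integral>\<^sup>+\<omega>. (\<integral>\<^sup>+h. F (\<omega>, h) * (ennreal (predicted t i \<omega> h) * inverse (evidence t \<omega>)) \<partial>prior) \<partial>M)"
proof -
  define a where "a = (\<lambda>\<omega> h. if i = 0 then 1 - hazard p X (Suc t) h \<omega> else hazard p X (Suc t) h \<omega>)"
  have [measurable]: "(\<lambda>(\<omega>, h). a \<omega> h) \<in> borel_measurable (obs t \<Otimes>\<^sub>M borel)"
    unfolding a_def case_prod_beta by measurable
  have alive: "(\<integral>\<^sup>+\<omega>. F (\<omega>, \<eta> \<omega>) * indicator (in_state t 0) \<omega> * indicator (in_state (Suc t) i) \<omega> \<partial>M) =
    (\<integral>\<^sup>+\<omega>. (\<integral>\<^sup>+h. F (\<omega>, h) * (ennreal (lik t 0 \<omega> h * a \<omega> h) * inverse (evidence t \<omega>)) \<partial>prior) \<partial>M)"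
  proof -
    have "(\<integral>\<^sup>+\<omega>. F (\<omega>, \<eta> \<omega>) * indicator (in_state t 0) \<omega> * indicator (in_state (Suc t) i) \<omega> \<partial>M) =
        (\<integral>\<^sup>+\<omega>. F (\<omega>, \<eta> \<omega>) * ennreal (a \<omega> (\<eta> \<omega>)) * indicator (in_state t 0) \<omega> \<partial>M)"
      by (subst transition_nn_integral[OF F i]) (simp add: a_def ac_simps)
    also have "\<dots> = (\<integral>\<^sup>+\<omega>. (\<integral>\<^sup>+h. F (\<omega>, h) * ennreal (a \<omega> h) *
        (ennreal (lik t 0 \<omega> h) * inverse (evidence t \<omega>)) \<partial>prior) \<partial>M)"
      using filter_formulaD[OF ff, of 0 "\<lambda>(\<omega>, h). F (\<omega>, h) * ennreal (a \<omega> h)"] by simp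
    also have "\<dots> = (\<integral>\<^sup>+\<omega>. (\<integral>\<^sup>+h. F (\<omega>, h) * (ennreal (lik t 0 \<omega> h * a \<omega> h) * inverse (evidence t \<omega>)) \<partial>prior) \<partial>M)"
      by (intro nn_integral_cong, subst ennreal_mult'[OF lik_nonneg]) (simp_all add: ac_simps)
    finally show ?thesis .
  qed
  show ?thesis
  proof (cases "i = 0")
    case True
    have "(\<integral>\<^sup>+\<omega>. F (\<omega>, \<eta> \<omega>) * indicator (in_state (Suc t) i) \<omega> \<partial>M) =
       (\<integral>\<^sup>+\<omega>. F (\<omega>, \<eta> \<omega>) * indicator (in_state t 0) \<omega> * indicator (in_state (Suc t) i) \<omega> \<partial>M)"
      using latent_Suc True
      by (intro nn_integral_cong) (fastforce simp: indicator_def latent_def split: if_splits)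
    then show ?thesis using alive True by (simp add: predicted_def a_def)
  next
    case False
    then have i1: "i = 1" using i by simp
    have "(\<integral>\<^sup>+\<omega>. F (\<omega>, \<eta> \<omega>) * indicator (in_state (Suc t) i) \<omega> \<partial>M) =
       (\<integral>\<^sup>+\<omega>. F (\<omega>, \<eta> \<omega>) * indicator (in_state t 1) \<omega> +
          F (\<omega>, \<eta> \<omega>) * indicator (in_state t 0) \<omega> * indicator (in_state (Suc t) i) \<omega> \<partial>M)"
      using latent_Suc i1
      by (intro nn_integral_cong) (fastforce simp: indicator_def latent_def split: if_splits)
    also have "\<dots> = (\<integral>\<^sup>+\<omega>. F (\<omega>, \<eta> \<omega>) * indicator (in_state t 1) \<omega> \<partial>M) +
        (\<integral>\<^sup>+\<omega>. F (\<omega>, \<eta> \<omega>) * indicator (in_state t 0) \<omega> * indicator (in_state (Suc t) i) \<omega> \<partial>M)"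
      by (rule nn_integral_add) measurable
    also have "\<dots> = (\<integral>\<^sup>+\<omega>. (\<integral>\<^sup>+h. F (\<omega>, h) * (ennreal (lik t 1 \<omega> h) * inverse (evidence t \<omega>)) \<partial>prior) \<partial>M) +
        (\<integral>\<^sup>+\<omega>. (\<integral>\<^sup>+h. F (\<omega>, h) * (ennreal (lik t 0 \<omega> h * a \<omega> h) * inverse (evidence t \<omega>)) \<partial>prior) \<partial>M)"
      using filter_formulaD[OF ff _ F, of 1] alive by simp
    also have "\<dots> = (\<integral>\<^sup>+\<omega>. (\<integral>\<^sup>+h. F (\<omega>, h) * (ennreal (lik t 1 \<omega> h) * inverse (evidence t \<omega>)) \<partial>prior) +
        (\<integral>\<^sup>+h. F (\<omega>, h) * (ennreal (lik t 0 \<omega> h * a \<omega> h) * inverse (evidence t \<omega>)) \<partial>prior) \<partial>M)"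
      by (rule nn_integral_add[symmetric]) measurable
    also have "\<dots> = (\<integral>\<^sup>+\<omega>. (\<integral>\<^sup>+h. F (\<omega>, h) * (ennreal (predicted t i \<omega> h) * inverse (evidence t \<omega>)) \<partial>prior) \<partial>M)"
    proof (rule nn_integral_cong)
      fix \<omega> assume \<omega>[measurable]: "\<omega> \<in> space M"
      then have [measurable]: "\<omega> \<in> space (obs t)" by simp
      have "(\<integral>\<^sup>+h. F (\<omega>, h) * (ennreal (lik t 1 \<omega> h) * inverse (evidence t \<omega>)) \<partial>prior) +
        (\<integral>\<^sup>+h. F (\<omega>, h) * (ennreal (lik t 0 \<omega> h * a \<omega> h) * inverse (evidence t \<omega>)) \<partial>prior) =
        (\<integral>\<^sup>+h. F (\<omega>, h) * (ennreal (lik t 1 \<omega> h) * inverse (evidence t \<omega>)) +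
         F (\<omega>, h) * (ennreal (lik t 0 \<omega> h * a \<omega> h) * inverse (evidence t \<omega>)) \<partial>prior)"
        by (rule nn_integral_add[symmetric]) measurable
      also have "\<dots> = (\<integral>\<^sup>+h. F (\<omega>, h) * (ennreal (predicted t i \<omega> h) * inverse (evidence t \<omega>)) \<partial>prior)"
        using \<omega> hazard_range[OF \<omega>]
        by (intro nn_integral_cong)
           (simp add: predicted_def a_def i1 lik_nonneg ennreal_plus distrib_left distrib_right)
      finally show "(\<integral>\<^sup>+h. F (\<omega>, h) * (ennreal (lik t 1 \<omega> h) * inverse (evidence t \<omega>)) \<partial>prior) +
        (\<integral>\<^sup>+h. F (\<omega>, h) * (ennreal (lik t 0 \<omega> h * a \<omega> h) * inverse (evidence t \<omega>)) \<partial>prior) =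
        (\<integral>\<^sup>+h. F (\<omega>, h) * (ennreal (predicted t i \<omega> h) * inverse (evidence t \<omega>)) \<partial>prior)" .
    qed
    finally show ?thesis .
  qed
qed

definition joint_density :: "nat \<Rightarrow> nat \<Rightarrow> 'w \<Rightarrow> 'h \<Rightarrow> 'y \<Rightarrow> ennreal" where
  "joint_density t i \<omega> h y = ennreal (predicted t i \<omega> h) * ennreal (response t i \<omega> h y)"

lemma joint_density_compose[measurable (raw)]:
  assumes "a \<in> measurable N (obs t)" "b \<in> measurable N borel" "c \<in> measurable N borel"
  shows "(\<lambda>z. joint_density t i (a z) (b z) (c z)) \<in> borel_measurable N"
  using assms unfolding joint_density_def by measurable

lemma joint_nn_integral:
  assumes ff: "filter_formula t" and i: "i \<in> {0, 1}"
    and F[measurable]: "F \<in> borel_measurable (obs t \<Otimes>\<^sub>M borel \<Otimes>\<^sub>M borel)"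
  shows "(\<integral>\<^sup>+\<omega>. F (\<omega>, \<eta> \<omega>, Y (Suc t) \<omega>) * indicator (in_state (Suc t) i) \<omega> \<partial>M) =
    (\<integral>\<^sup>+\<omega>. (\<integral>\<^sup>+y. (\<integral>\<^sup>+h. F (\<omega>, h, y) * joint_density t i \<omega> h y \<partial>prior) * inverse (evidence t \<omega>) \<partial>\<mu>) \<partial>M)"
proof -
  have "(\<integral>\<^sup>+\<omega>. F (\<omega>, \<eta> \<omega>, Y (Suc t) \<omega>) * indicator (in_state (Suc t) i) \<omega> \<partial>M) =
     (\<integral>\<^sup>+\<omega>. (\<integral>\<^sup>+y. F (\<omega>, \<eta> \<omega>, y) * ennreal (response t i \<omega> (\<eta> \<omega>) y) \<partial>\<mu>) *
      indicator (in_state (Suc t) i) \<omega> \<partial>M)"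
    by (rule response_nn_integral[OF F i])
  also have "\<dots> = (\<integral>\<^sup>+\<omega>. (\<integral>\<^sup>+h. (\<integral>\<^sup>+y. F (\<omega>, h, y) * ennreal (response t i \<omega> h y) \<partial>\<mu>) *
      (ennreal (predicted t i \<omega> h) * inverse (evidence t \<omega>)) \<partial>prior) \<partial>M)"
    using predicted_nn_integral[OF ff i,
        of "\<lambda>(\<omega>, h). \<integral>\<^sup>+y. F (\<omega>, h, y) * ennreal (response t i \<omega> h y) \<partial>\<mu>"] by simp
  also have "\<dots> = (\<integral>\<^sup>+\<omega>. (\<integral>\<^sup>+y. (\<integral>\<^sup>+h. F (\<omega>, h, y) * joint_density t i \<omega> h y \<partial>prior) * inverse (evidence t \<omega>) \<partial>\<mu>) \<partial>M)"
  proof (rule nn_integral_cong)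
    fix \<omega> assume \<omega>[measurable]: "\<omega> \<in> space M"
    then have [measurable]: "\<omega> \<in> space (obs t)" by simp
    have "(\<integral>\<^sup>+h. (\<integral>\<^sup>+y. F (\<omega>, h, y) * ennreal (response t i \<omega> h y) \<partial>\<mu>) *
      (ennreal (predicted t i \<omega> h) * inverse (evidence t \<omega>)) \<partial>prior) =
      (\<integral>\<^sup>+h. (\<integral>\<^sup>+y. F (\<omega>, h, y) * joint_density t i \<omega> h y * inverse (evidence t \<omega>) \<partial>\<mu>) \<partial>prior)"
      unfolding joint_density_def
      by (intro nn_integral_cong, subst nn_integral_multc[symmetric], measurable)
         (simp add: ac_simps)
    also have "\<dots> = (\<integral>\<^sup>+y. (\<integral>\<^sup>+h. F (\<omega>, h, y) * joint_density t i \<omega> h y * inverse (evidence t \<omega>) \<partial>prior) \<partial>\<mu>)"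
      by (rule pair.Fubini'[symmetric]) measurable
    also have "\<dots> = (\<integral>\<^sup>+y. (\<integral>\<^sup>+h. F (\<omega>, h, y) * joint_density t i \<omega> h y \<partial>prior) * inverse (evidence t \<omega>) \<partial>\<mu>)"
      by (intro nn_integral_cong nn_integral_multc) measurable
    finally show "(\<integral>\<^sup>+h. (\<integral>\<^sup>+y. F (\<omega>, h, y) * ennreal (response t i \<omega> h y) \<partial>\<mu>) *
      (ennreal (predicted t i \<omega> h) * inverse (evidence t \<omega>)) \<partial>prior) =
      (\<integral>\<^sup>+y. (\<integral>\<^sup>+h. F (\<omega>, h, y) * joint_density t i \<omega> h y \<partial>prior) * inverse (evidence t \<omega>) \<partial>\<mu>)" .
  qed
  finally show ?thesis .
qed

definition marginal_density :: "nat \<Rightarrow> 'w \<Rightarrow> 'y \<Rightarrow> ennreal" where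
  "marginal_density t \<omega> y = (\<integral>\<^sup>+h. joint_density t 0 \<omega> h y + joint_density t 1 \<omega> h y \<partial>prior)"

lemma marginal_density_compose[measurable (raw)]:
  assumes [measurable]: "a \<in> measurable N (obs t)" "c \<in> measurable N borel"
  shows "(\<lambda>z. marginal_density t (a z) (c z)) \<in> borel_measurable N"
  unfolding marginal_density_def by measurable

lemma joint_density_lik:
  assumes "\<omega> \<in> space M"
  shows "joint_density t i \<omega> h (Y (Suc t) \<omega>) = ennreal (lik (Suc t) i \<omega> h)"
  by (simp add: joint_density_def lik_Suc ennreal_mult' predicted_nonneg[OF assms])

lemma evidence_Suc:
  assumes "\<omega> \<in> space M"
  shows "evidence (Suc t) \<omega> = marginal_density t \<omega> (Y (Suc t) \<omega>)"
  by (simp add: evidence_def marginal_density_def joint_density_lik[OF assms])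

lemma nn_integral_marginal_density:
  assumes \<omega>: "\<omega> \<in> space M"
  shows "(\<integral>\<^sup>+y. marginal_density t \<omega> y \<partial>\<mu>) = evidence t \<omega>"
proof -
  have [measurable]: "\<omega> \<in> space (obs t)" using \<omega> by simp
  have "(\<integral>\<^sup>+y. marginal_density t \<omega> y \<partial>\<mu>) =
      (\<integral>\<^sup>+h. (\<integral>\<^sup>+y. joint_density t 0 \<omega> h y + joint_density t 1 \<omega> h y \<partial>\<mu>) \<partial>prior)"
    unfolding marginal_density_def by (rule pair.Fubini') measurable
  also have "\<dots> = (\<integral>\<^sup>+h. ennreal (predicted t 0 \<omega> h) + ennreal (predicted t 1 \<omega> h) \<partial>prior)"
  proof (rule nn_integral_cong)
    fix h
    have m: "joint_density t i \<omega> h \<in> borel_measurable \<mu>" for i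
      using joint_density_compose[of "\<lambda>_. \<omega>" \<mu> t "\<lambda>_. h" "\<lambda>y. y" i] \<omega>
      by (simp cong: measurable_cong_sets add: mu_sets)
    have "(\<integral>\<^sup>+y. joint_density t i \<omega> h y \<partial>\<mu>) = ennreal (predicted t i \<omega> h)" for i
      unfolding joint_density_def
      by (subst nn_integral_cmult) (measurable, simp add: response_density[OF \<omega>])
    then show "(\<integral>\<^sup>+y. joint_density t 0 \<omega> h y + joint_density t 1 \<omega> h y \<partial>\<mu>) =
        ennreal (predicted t 0 \<omega> h) + ennreal (predicted t 1 \<omega> h)"
      by (simp add: nn_integral_add[OF m m])
  qed
  also have "\<dots> = evidence t \<omega>"
    unfolding evidence_def
  proof (rule nn_integral_cong)
    fix h
    have "predicted t 0 \<omega> h + predicted t 1 \<omega> h = lik t 0 \<omega> h + lik t 1 \<omega> h"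
      by (simp add: predicted_def algebra_simps)
    then show "ennreal (predicted t 0 \<omega> h) + ennreal (predicted t 1 \<omega> h) =
        ennreal (lik t 0 \<omega> h) + ennreal (lik t 1 \<omega> h)"
      by (simp add: predicted_nonneg lik_nonneg \<omega> flip: ennreal_plus)
  qed
  finally show ?thesis .
qed

lemma marginal_nn_integral:
  assumes ff: "filter_formula t" and H[measurable]: "H \<in> borel_measurable (obs t \<Otimes>\<^sub>M borel)"
  shows "(\<integral>\<^sup>+\<omega>. H (\<omega>, Y (Suc t) \<omega>) \<partial>M) =
    (\<integral>\<^sup>+\<omega>. (\<integral>\<^sup>+y. H (\<omega>, y) * marginal_density t \<omega> y * inverse (evidence t \<omega>) \<partial>\<mu>) \<partial>M)"
proof -
  let ?J = "\<lambda>i \<omega>. \<integral>\<^sup>+y. (\<integral>\<^sup>+h. H (\<omega>, y) * joint_density t i \<omega> h y \<partial>prior) * inverse (evidence t \<omega>) \<partial>\<mu>"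
  have J: "(\<integral>\<^sup>+\<omega>. H (\<omega>, Y (Suc t) \<omega>) * indicator (in_state (Suc t) i) \<omega> \<partial>M) = (\<integral>\<^sup>+\<omega>. ?J i \<omega> \<partial>M)"
    if "i \<in> {0, 1}" for i
    using joint_nn_integral[OF ff that, of "\<lambda>(\<omega>, h, y). H (\<omega>, y)"] by simp
  have "(\<integral>\<^sup>+\<omega>. H (\<omega>, Y (Suc t) \<omega>) \<partial>M) =
      (\<integral>\<^sup>+\<omega>. H (\<omega>, Y (Suc t) \<omega>) * indicator (in_state (Suc t) 0) \<omega> +
        H (\<omega>, Y (Suc t) \<omega>) * indicator (in_state (Suc t) 1) \<omega> \<partial>M)"
    by (intro nn_integral_cong) (auto simp: indicator_def latent_def)
  also have "\<dots> = (\<integral>\<^sup>+\<omega>. H (\<omega>, Y (Suc t) \<omega>) * indicator (in_state (Suc t) 0) \<omega> \<partial>M) +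
      (\<integral>\<^sup>+\<omega>. H (\<omega>, Y (Suc t) \<omega>) * indicator (in_state (Suc t) 1) \<omega> \<partial>M)"
    by (rule nn_integral_add) measurable
  also have "\<dots> = (\<integral>\<^sup>+\<omega>. ?J 0 \<omega> \<partial>M) + (\<integral>\<^sup>+\<omega>. ?J 1 \<omega> \<partial>M)"
    using J[of 0] J[of 1] by simp
  also have "\<dots> = (\<integral>\<^sup>+\<omega>. ?J 0 \<omega> + ?J 1 \<omega> \<partial>M)"
    by (rule nn_integral_add[symmetric]) measurable
  also have "\<dots> = (\<integral>\<^sup>+\<omega>. (\<integral>\<^sup>+y. H (\<omega>, y) * marginal_density t \<omega> y * inverse (evidence t \<omega>) \<partial>\<mu>) \<partial>M)"
  proof (rule nn_integral_cong)
    fix \<omega> assume \<omega>: "\<omega> \<in> space M"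
    then have [measurable]: "\<omega> \<in> space (obs t)" by simp
    have "?J 0 \<omega> + ?J 1 \<omega> =
      (\<integral>\<^sup>+y. (\<integral>\<^sup>+h. H (\<omega>, y) * joint_density t 0 \<omega> h y \<partial>prior) * inverse (evidence t \<omega>) +
        (\<integral>\<^sup>+h. H (\<omega>, y) * joint_density t 1 \<omega> h y \<partial>prior) * inverse (evidence t \<omega>) \<partial>\<mu>)"
      by (rule nn_integral_add[symmetric]) measurable
    also have "\<dots> = (\<integral>\<^sup>+y. H (\<omega>, y) * marginal_density t \<omega> y * inverse (evidence t \<omega>) \<partial>\<mu>)"
      unfolding marginal_density_def
      by (intro nn_integral_cong, subst nn_integral_add, measurable)
         (simp add: nn_integral_cmult distrib_left distrib_right)
    finally show "?J 0 \<omega> + ?J 1 \<omega> =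
      (\<integral>\<^sup>+y. H (\<omega>, y) * marginal_density t \<omega> y * inverse (evidence t \<omega>) \<partial>\<mu>)" .
  qed
  finally show ?thesis .
qed

lemma AE_marginal_density_finite:
  assumes "filter_formula t"
  shows "AE \<omega> in M. AE y in \<mu>. marginal_density t \<omega> y \<noteq> \<top>"
proof -
  have "AE \<omega> in M. evidence t \<omega> \<noteq> \<top>"
    using assms by (auto simp: filter_formula_def)
  with AE_space show ?thesis
  proof eventually_elim
    fix \<omega> assume \<omega>: "\<omega> \<in> space M" and ev: "evidence t \<omega> \<noteq> \<top>"
    have [measurable]: "\<omega> \<in> space (obs t)" using \<omega> by simp
    have "(\<lambda>y. marginal_density t \<omega> y) \<in> borel_measurable \<mu>" by measurable
    then show "AE y in \<mu>. marginal_density t \<omega> y \<noteq> \<top>"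
      using nn_integral_PInf_AE[of "marginal_density t \<omega>" \<mu>] ev
      by (simp add: nn_integral_marginal_density[OF \<omega>])
  qed
qed

lemma obs_Suc_factor:
  assumes "A \<in> sets (obs (Suc t))"
  obtains A' where "A' \<in> sets (obs t \<Otimes>\<^sub>M borel)" "A = {\<omega> \<in> space M. (\<omega>, Y (Suc t) \<omega>) \<in> A'}"
proof -
  define V where "V = vimage_algebra (space M) (\<lambda>\<omega>. (\<omega>, Y (Suc t) \<omega>)) (obs t \<Otimes>\<^sub>M (borel :: 'y measure))"
  have spV: "space V = space M" by (simp add: V_def)
  have pair: "(\<lambda>\<omega>. (\<omega>, Y (Suc t) \<omega>)) \<in> measurable V (obs t \<Otimes>\<^sub>M borel)"
    unfolding V_def by (rule measurable_vimage_algebra1) (auto simp: space_pair_measure)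
  have [measurable]: "(\<lambda>\<omega>. \<omega>) \<in> measurable V (obs t)"
    using measurable_compose[OF pair measurable_fst] by simp
  have [measurable]: "Y (Suc t) \<in> measurable V borel"
    using measurable_compose[OF pair measurable_snd] by simp
  have sub: "subalgebra V (obs t)"
  proof -
    have "A \<in> sets V" if "A \<in> sets (obs t)" for A
    proof -
      have "(\<lambda>\<omega>. \<omega>) -` A \<inter> space V \<in> sets V" by (rule measurable_sets[OF _ that]) measurable
      moreover have "(\<lambda>\<omega>. \<omega>) -` A \<inter> space V = A"
        using sets.sets_into_space[OF that] by (auto simp: spV)
      ultimately show ?thesis by simp
    qed
    then show ?thesis by (auto simp: subalgebra_def spV)
  qed
  have "X s \<in> measurable (obs t) (count_space UNIV)" if "s \<in> {1..Suc t}" for s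
    using that X_obs[of s t] X_predictable_UNIV[of t] by (cases "s = Suc t") auto
  then have "X s \<in> measurable V (count_space UNIV)" if "s \<in> {1..Suc t}" for s
    using that measurable_from_subalg[OF sub] by blast
  moreover have "Y s \<in> measurable V borel" if "s \<in> {1..Suc t}" for s
  proof (cases "s = Suc t")
    case False
    then show ?thesis using that by (intro measurable_from_subalg[OF sub] Y_obs) auto
  qed simp
  ultimately have "obs_preimages M X Y (Suc t) \<subseteq> sets V"
    unfolding obs_preimages_def
    by (intro UN_least Un_least preimages_subset_sets[OF spV])
  then have "sets (obs (Suc t)) \<subseteq> sets V"
    unfolding obs_algebra_def by (rule sigma_subset_sets[OF spV])
  then have "A \<in> sets V" using assms by auto
  then obtain A' where "A' \<in> sets (obs t \<Otimes>\<^sub>M borel)"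
    "A = (\<lambda>\<omega>. (\<omega>, Y (Suc t) \<omega>)) -` A' \<inter> space M"
    unfolding V_def by (subst (asm) sets_vimage_algebra2) (auto simp: space_pair_measure)
  then show ?thesis using that[of A'] by auto
qed

lemma filter_formula_Suc:
  assumes ff: "filter_formula t"
  shows "filter_formula (Suc t)"
proof (rule filter_formulaI)
  have "(\<integral>\<^sup>+\<omega>. indicator {0, \<top>} (marginal_density t \<omega> (Y (Suc t) \<omega>)) \<partial>M) =
    (\<integral>\<^sup>+\<omega>. (\<integral>\<^sup>+y. indicator {0, \<top>} (marginal_density t \<omega> y) * marginal_density t \<omega> y * inverse (evidence t \<omega>) \<partial>\<mu>) \<partial>M)"
    using marginal_nn_integral[OF ff, of "\<lambda>(\<omega>, y). indicator {0, \<top>} (marginal_density t \<omega> y)"] by simp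
  also have "\<dots> = (\<integral>\<^sup>+\<omega>. 0 \<partial>M)"
  proof (rule nn_integral_cong_AE)
    show "AE \<omega> in M. (\<integral>\<^sup>+y. indicator {0, \<top>} (marginal_density t \<omega> y) * marginal_density t \<omega> y * inverse (evidence t \<omega>) \<partial>\<mu>) = 0"
      using AE_marginal_density_finite[OF ff]
    proof eventually_elim
      fix \<omega> assume "AE y in \<mu>. marginal_density t \<omega> y \<noteq> \<top>"
      then have "AE y in \<mu>. indicator {0, \<top>} (marginal_density t \<omega> y) * marginal_density t \<omega> y * inverse (evidence t \<omega>) = 0"
        by eventually_elim (auto simp: indicator_def)
      then have "(\<integral>\<^sup>+y. indicator {0, \<top>} (marginal_density t \<omega> y) * marginal_density t \<omega> y * inverse (evidence t \<omega>) \<partial>\<mu>) = (\<integral>\<^sup>+y. 0 \<partial>\<mu>)"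
        by (rule nn_integral_cong_AE)
      then show "(\<integral>\<^sup>+y. indicator {0, \<top>} (marginal_density t \<omega> y) * marginal_density t \<omega> y * inverse (evidence t \<omega>) \<partial>\<mu>) = 0"
        by simp
    qed
  qed
  also have "\<dots> = 0" by simp
  finally have "(\<integral>\<^sup>+\<omega>. indicator {0, \<top>} (marginal_density t \<omega> (Y (Suc t) \<omega>)) \<partial>M) = 0" .
  moreover have "(\<lambda>\<omega>. indicator {0, \<top>} (marginal_density t \<omega> (Y (Suc t) \<omega>)) :: ennreal) \<in> borel_measurable M"
    by measurable
  ultimately have "AE \<omega> in M. indicator {0, \<top>} (marginal_density t \<omega> (Y (Suc t) \<omega>)) = (0 :: ennreal)"
    by (simp add: nn_integral_0_iff_AE)
  with AE_space show "AE \<omega> in M. evidence (Suc t) \<omega> \<noteq> 0 \<and> evidence (Suc t) \<omega> \<noteq> \<top>"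
    by eventually_elim (auto simp: evidence_Suc indicator_def split: if_splits)
next
  fix i :: nat and A :: "'w set" and C :: "'h set"
  assume i: "i \<in> {0, 1}" and A: "A \<in> sets (obs (Suc t))" and C[measurable]: "C \<in> sets borel"
  obtain A' where A'[measurable]: "A' \<in> sets (obs t \<Otimes>\<^sub>M borel)"
    and A_eq: "A = {\<omega> \<in> space M. (\<omega>, Y (Suc t) \<omega>) \<in> A'}"
    by (rule obs_Suc_factor[OF A])
  define L where "L \<omega> y = (\<integral>\<^sup>+h. indicator C h * joint_density t i \<omega> h y \<partial>prior)" for \<omega> y
  have L[measurable]: "(\<lambda>(\<omega>, y). L \<omega> y) \<in> borel_measurable (obs t \<Otimes>\<^sub>M borel)"
    unfolding L_def by measurable
  have L_le: "L \<omega> y \<le> marginal_density t \<omega> y" for \<omega> y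
    unfolding L_def marginal_density_def using i
    by (intro nn_integral_mono) (auto simp: indicator_def)
  have "(\<integral>\<^sup>+\<omega>. indicator A \<omega> * indicator C (\<eta> \<omega>) * indicator (in_state (Suc t) i) \<omega> \<partial>M) =
      (\<integral>\<^sup>+\<omega>. indicator A' (\<omega>, Y (Suc t) \<omega>) * indicator C (\<eta> \<omega>) * indicator (in_state (Suc t) i) \<omega> \<partial>M)"
    by (intro nn_integral_cong) (auto simp: A_eq indicator_def)
  also have "\<dots> = (\<integral>\<^sup>+\<omega>. (\<integral>\<^sup>+y. (\<integral>\<^sup>+h. indicator A' (\<omega>, y) * indicator C h * joint_density t i \<omega> h y \<partial>prior)
      * inverse (evidence t \<omega>) \<partial>\<mu>) \<partial>M)"
    using joint_nn_integral[OF ff i, of "\<lambda>(\<omega>, h, y). indicator A' (\<omega>, y) * indicator C h"] by simp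
  also have "\<dots> = (\<integral>\<^sup>+\<omega>. (\<integral>\<^sup>+y. indicator A' (\<omega>, y) * L \<omega> y * inverse (evidence t \<omega>) \<partial>\<mu>) \<partial>M)"
  proof (rule nn_integral_cong, rule nn_integral_cong)
    fix \<omega> y assume "\<omega> \<in> space M"
    then have [measurable]: "\<omega> \<in> space (obs t)" by simp
    show "(\<integral>\<^sup>+h. indicator A' (\<omega>, y) * indicator C h * joint_density t i \<omega> h y \<partial>prior)
      * inverse (evidence t \<omega>) = indicator A' (\<omega>, y) * L \<omega> y * inverse (evidence t \<omega>)"
      unfolding L_def by (subst nn_integral_cmult[symmetric], measurable) (simp add: mult.assoc)
  qed
  also have "\<dots> = (\<integral>\<^sup>+\<omega>. (\<integral>\<^sup>+y. (indicator A' (\<omega>, y) * (L \<omega> y * inverse (marginal_density t \<omega> y))) *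
      marginal_density t \<omega> y * inverse (evidence t \<omega>) \<partial>\<mu>) \<partial>M)"
  proof (rule nn_integral_cong_AE)
    show "AE \<omega> in M. (\<integral>\<^sup>+y. indicator A' (\<omega>, y) * L \<omega> y * inverse (evidence t \<omega>) \<partial>\<mu>) =
      (\<integral>\<^sup>+y. (indicator A' (\<omega>, y) * (L \<omega> y * inverse (marginal_density t \<omega> y))) *
      marginal_density t \<omega> y * inverse (evidence t \<omega>) \<partial>\<mu>)"
      using AE_marginal_density_finite[OF ff]
    proof (eventually_elim, intro nn_integral_cong_AE)
      fix \<omega> assume "AE y in \<mu>. marginal_density t \<omega> y \<noteq> \<top>"
      then show "AE y in \<mu>. indicator A' (\<omega>, y) * L \<omega> y * inverse (evidence t \<omega>) =
        (indicator A' (\<omega>, y) * (L \<omega> y * inverse (marginal_density t \<omega> y))) *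
        marginal_density t \<omega> y * inverse (evidence t \<omega>)"
      proof eventually_elim
        fix y assume fin: "marginal_density t \<omega> y \<noteq> \<top>"
        have "L \<omega> y * (inverse (marginal_density t \<omega> y) * marginal_density t \<omega> y) = L \<omega> y"
        proof (cases "marginal_density t \<omega> y = 0")
          case True
          then show ?thesis using L_le[of \<omega> y] by simp
        next
          case False
          then have "inverse (marginal_density t \<omega> y) * marginal_density t \<omega> y = 1"
            using fin ennreal_divide_self[of "marginal_density t \<omega> y"]
            by (simp add: divide_ennreal_def mult.commute less_top)
          then show ?thesis by simp
        qed
        then show "indicator A' (\<omega>, y) * L \<omega> y * inverse (evidence t \<omega>) =
          (indicator A' (\<omega>, y) * (L \<omega> y * inverse (marginal_density t \<omega> y))) *
          marginal_density t \<omega> y * inverse (evidence t \<omega>)"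
          by (simp add: mult.assoc)
      qed
    qed
  qed
  also have "\<dots> = (\<integral>\<^sup>+\<omega>. indicator A' (\<omega>, Y (Suc t) \<omega>) *
      (L \<omega> (Y (Suc t) \<omega>) * inverse (marginal_density t \<omega> (Y (Suc t) \<omega>))) \<partial>M)"
    using marginal_nn_integral[OF ff, of "\<lambda>(\<omega>, y). indicator A' (\<omega>, y) * (L \<omega> y * inverse (marginal_density t \<omega> y))"]
    by simp
  also have "\<dots> = (\<integral>\<^sup>+\<omega>. indicator A \<omega> * (\<integral>\<^sup>+h. indicator C h *
        (ennreal (lik (Suc t) i \<omega> h) * inverse (evidence (Suc t) \<omega>)) \<partial>prior) \<partial>M)"
  proof (rule nn_integral_cong)
    fix \<omega> assume \<omega>: "\<omega> \<in> space M"
    then have [measurable]: "\<omega> \<in> space (obs t)" "\<omega> \<in> space (obs (Suc t))" by simp_all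
    have "indicator A' (\<omega>, Y (Suc t) \<omega>) = (indicator A \<omega> :: ennreal)"
      using \<omega> by (simp add: A_eq indicator_def)
    moreover have "L \<omega> (Y (Suc t) \<omega>) * inverse (marginal_density t \<omega> (Y (Suc t) \<omega>)) =
        (\<integral>\<^sup>+h. indicator C h * (ennreal (lik (Suc t) i \<omega> h) * inverse (evidence (Suc t) \<omega>)) \<partial>prior)"
      unfolding L_def joint_density_lik[OF \<omega>] evidence_Suc[OF \<omega>, symmetric]
      by (subst nn_integral_multc[symmetric], measurable) (simp add: mult.assoc)
    ultimately show "indicator A' (\<omega>, Y (Suc t) \<omega>) *
      (L \<omega> (Y (Suc t) \<omega>) * inverse (marginal_density t \<omega> (Y (Suc t) \<omega>))) =
      indicator A \<omega> * (\<integral>\<^sup>+h. indicator C h *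
        (ennreal (lik (Suc t) i \<omega> h) * inverse (evidence (Suc t) \<omega>)) \<partial>prior)"
      by simp
  qed
  finally show "(\<integral>\<^sup>+\<omega>. indicator A \<omega> * indicator C (\<eta> \<omega>) * indicator (in_state (Suc t) i) \<omega> \<partial>M) =
      (\<integral>\<^sup>+\<omega>. indicator A \<omega> * (\<integral>\<^sup>+h. indicator C h *
        (ennreal (lik (Suc t) i \<omega> h) * inverse (evidence (Suc t) \<omega>)) \<partial>prior) \<partial>M)" .
qed

lemma filter_formula: "filter_formula t"
  by (induction t) (auto intro: filter_formula_0 filter_formula_Suc)


section \<open>The posterior law of the parameter\<close>

lemma lik_no_change: "lik t 0 \<omega> h = no_change_likelihood p\<^sub>0 p f X Y t h \<omega>"
proof (induction t)
  case 0
  show ?case by (simp add: no_change_likelihood_def)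
next
  case (Suc t)
  have "no_change_likelihood p\<^sub>0 p f X Y (Suc t) h \<omega> = no_change_likelihood p\<^sub>0 p f X Y t h \<omega> *
      ((1 - hazard p X (Suc t) h \<omega>) * f (X (Suc t) \<omega>) h (Y (Suc t) \<omega>))"
    by (simp add: no_change_likelihood_def prod.nat_ivl_Suc')
  then show ?case by (simp add: lik_Suc predicted_def response_def Suc)
qed

lemma AE_response_ratio:
  "AE \<omega> in M. AE h in prior. response t 0 \<omega> h (Y (Suc t) \<omega>) = 0 \<longrightarrow> response t 1 \<omega> h (Y (Suc t) \<omega>) = 0"
proof -
  define N :: "'w \<Rightarrow> 'h \<Rightarrow> 'y \<Rightarrow> ennreal"
    where "N \<omega> h y = (if response t 0 \<omega> h y = 0 \<and> response t 1 \<omega> h y \<noteq> 0 then 1 else 0)" for \<omega> h y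
  define H where "H \<omega> y = (\<integral>\<^sup>+h. N \<omega> h y \<partial>prior)" for \<omega> y
  have [measurable]: "(\<lambda>(\<omega>, y). H \<omega> y) \<in> borel_measurable (obs t \<Otimes>\<^sub>M borel)"
    unfolding H_def N_def by measurable
  have H0: "AE y in \<mu>. H \<omega> y = 0" if \<omega>: "\<omega> \<in> space M" for \<omega>
  proof -
    have [measurable]: "\<omega> \<in> space (obs t)" using \<omega> by simp
    have "(\<integral>\<^sup>+y. H \<omega> y \<partial>\<mu>) = (\<integral>\<^sup>+h. (\<integral>\<^sup>+y. N \<omega> h y \<partial>\<mu>) \<partial>prior)"
      unfolding H_def by (rule pair.Fubini') (unfold N_def, measurable)
    also have "\<dots> = (\<integral>\<^sup>+h. 0 \<partial>prior)"
    proof (rule nn_integral_cong)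
      fix h
      have "AE y in \<mu>. N \<omega> h y = 0"
        using ratio_defined[OF X_range[OF _ \<omega>, of "Suc t"], of h]
        by (simp add: N_def response_def)
      then have "(\<integral>\<^sup>+y. N \<omega> h y \<partial>\<mu>) = (\<integral>\<^sup>+y. 0 \<partial>\<mu>)" by (rule nn_integral_cong_AE)
      then show "(\<integral>\<^sup>+y. N \<omega> h y \<partial>\<mu>) = 0" by simp
    qed
    finally have "(\<integral>\<^sup>+y. H \<omega> y \<partial>\<mu>) = 0" by simp
    moreover have "(\<lambda>y. H \<omega> y) \<in> borel_measurable \<mu>" unfolding H_def N_def by measurable
    ultimately show ?thesis by (simp add: nn_integral_0_iff_AE)
  qed
  have "(\<integral>\<^sup>+y. H \<omega> y * marginal_density t \<omega> y * inverse (evidence t \<omega>) \<partial>\<mu>) = (\<integral>\<^sup>+y. 0 \<partial>\<mu>)"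
    if "\<omega> \<in> space M" for \<omega>
    by (rule nn_integral_cong_AE) (use H0[OF that] in eventually_elim, simp)
  then have "(\<integral>\<^sup>+\<omega>. (\<integral>\<^sup>+y. H \<omega> y * marginal_density t \<omega> y * inverse (evidence t \<omega>) \<partial>\<mu>) \<partial>M) = (\<integral>\<^sup>+\<omega>. 0 \<partial>M)"
    by (intro nn_integral_cong) simp
  then have "(\<integral>\<^sup>+\<omega>. H \<omega> (Y (Suc t) \<omega>) \<partial>M) = 0"
    using marginal_nn_integral[OF filter_formula[of t], of "\<lambda>(\<omega>, y). H \<omega> y"] by simp
  moreover have "(\<lambda>\<omega>. H \<omega> (Y (Suc t) \<omega>)) \<in> borel_measurable M"
    unfolding H_def N_def by measurable
  ultimately have "AE \<omega> in M. H \<omega> (Y (Suc t) \<omega>) = 0"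
    by (simp add: nn_integral_0_iff_AE)
  with AE_space show ?thesis
  proof eventually_elim
    fix \<omega> assume \<omega>: "\<omega> \<in> space M" and "H \<omega> (Y (Suc t) \<omega>) = 0"
    have [measurable]: "\<omega> \<in> space (obs t)" using \<omega> by simp
    have "(\<lambda>h. N \<omega> h (Y (Suc t) \<omega>)) \<in> borel_measurable prior"
      unfolding N_def by measurable
    then have "AE h in prior. N \<omega> h (Y (Suc t) \<omega>) = 0"
      using \<open>H \<omega> (Y (Suc t) \<omega>) = 0\<close> unfolding H_def by (simp add: nn_integral_0_iff_AE)
    then show "AE h in prior. response t 0 \<omega> h (Y (Suc t) \<omega>) = 0 \<longrightarrow> response t 1 \<omega> h (Y (Suc t) \<omega>) = 0"
      by eventually_elim (auto simp: N_def split: if_splits)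
  qed
qed

lemma AE_change_likelihood:
  "AE \<omega> in M. AE h in prior.
    no_change_likelihood p\<^sub>0 p f X Y t h \<omega> * change_odds p\<^sub>0 p f g X Y t h \<omega> = lik t 1 \<omega> h"
proof (induction t)
  case 0
  have "no_change_likelihood p\<^sub>0 p f X Y 0 h \<omega> * change_odds p\<^sub>0 p f g X Y 0 h \<omega> = lik 0 1 \<omega> h" for \<omega> h
    using p0_range[of h] by (simp add: no_change_likelihood_def)
  then show ?case by simp
next
  case (Suc t)
  from Suc AE_response_ratio[of t] AE_space show ?case
  proof eventually_elim
    fix \<omega> assume \<omega>: "\<omega> \<in> space M"
    assume "AE h in prior. response t 0 \<omega> h (Y (Suc t) \<omega>) = 0 \<longrightarrow> response t 1 \<omega> h (Y (Suc t) \<omega>) = 0"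
      and "AE h in prior.
        no_change_likelihood p\<^sub>0 p f X Y t h \<omega> * change_odds p\<^sub>0 p f g X Y t h \<omega> = lik t 1 \<omega> h"
    then show "AE h in prior. no_change_likelihood p\<^sub>0 p f X Y (Suc t) h \<omega> *
        change_odds p\<^sub>0 p f g X Y (Suc t) h \<omega> = lik (Suc t) 1 \<omega> h"
    proof eventually_elim
      fix h
      let ?\<pi> = "hazard p X (Suc t) h \<omega>"
      let ?f = "f (X (Suc t) \<omega>) h (Y (Suc t) \<omega>)" and ?g = "g (X (Suc t) \<omega>) h (Y (Suc t) \<omega>)"
      assume "response t 0 \<omega> h (Y (Suc t) \<omega>) = 0 \<longrightarrow> response t 1 \<omega> h (Y (Suc t) \<omega>) = 0"
        and IH: "no_change_likelihood p\<^sub>0 p f X Y t h \<omega> * change_odds p\<^sub>0 p f g X Y t h \<omega> = lik t 1 \<omega> h"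
      then have fg: "?f = 0 \<longrightarrow> ?g = 0" by (simp add: response_def)
      have "1 - ?\<pi> \<noteq> 0" using hazard_range[OF \<omega>, of t h] by simp
      then have cancel: "(1 - ?\<pi>) * ?f * (?g / ?f / (1 - ?\<pi>)) = ?g"
        using fg by (cases "?f = 0") auto
      have "no_change_likelihood p\<^sub>0 p f X Y (Suc t) h \<omega> * change_odds p\<^sub>0 p f g X Y (Suc t) h \<omega> =
        (lik t 0 \<omega> h * change_odds p\<^sub>0 p f g X Y t h \<omega> + lik t 0 \<omega> h * ?\<pi>) *
        ((1 - ?\<pi>) * ?f * (?g / ?f / (1 - ?\<pi>)))"
        unfolding lik_no_change[symmetric] lik_Suc
        by (simp add: likelihood_ratio_def predicted_def response_def algebra_simps)
      also have "\<dots> = lik (Suc t) 1 \<omega> h"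
        unfolding cancel by (simp add: lik_no_change IH lik_Suc predicted_def response_def)
      finally show "no_change_likelihood p\<^sub>0 p f X Y (Suc t) h \<omega> *
        change_odds p\<^sub>0 p f g X Y (Suc t) h \<omega> = lik (Suc t) 1 \<omega> h" .
    qed
  qed
qed

lemma change_odds_measurable:
  assumes \<omega>: "\<omega> \<in> space M"
  shows "(\<lambda>h. change_odds p\<^sub>0 p f g X Y t h \<omega>) \<in> borel_measurable borel"
proof (induction t)
  case 0
  note p0_measurable[measurable]
  show ?case by simp
next
  case (Suc t)
  note Suc[measurable]
  have [measurable]: "\<omega> \<in> space (obs t)" using \<omega> by simp
  have lr: "likelihood_ratio f g X Y (Suc t) h \<omega> =
      response t 1 \<omega> h (Y (Suc t) \<omega>) / response t 0 \<omega> h (Y (Suc t) \<omega>)" for h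
    by (simp add: likelihood_ratio_def response_def)
  show ?case by (simp add: lr)
qed

lemma integral_posterior_weight:
  assumes [measurable]: "C \<in> sets borel"
  shows "AE \<omega> in M. (\<integral>h. no_change_likelihood p\<^sub>0 p f X Y t h \<omega> *
      (1 + change_odds p\<^sub>0 p f g X Y t h \<omega>) * indicator C h \<partial>prior) =
    enn2real (\<integral>\<^sup>+h. indicator C h * (ennreal (lik t 0 \<omega> h) + ennreal (lik t 1 \<omega> h)) \<partial>prior)"
  using AE_change_likelihood[of t] AE_space
proof eventually_elim
  fix \<omega> assume \<omega>: "\<omega> \<in> space M"
  assume AE: "AE h in prior.
    no_change_likelihood p\<^sub>0 p f X Y t h \<omega> * change_odds p\<^sub>0 p f g X Y t h \<omega> = lik t 1 \<omega> h"
  have [measurable]: "\<omega> \<in> space (obs t)" using \<omega> by simp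
  note change_odds_measurable[OF \<omega>, measurable]
  have "(\<integral>h. no_change_likelihood p\<^sub>0 p f X Y t h \<omega> *
      (1 + change_odds p\<^sub>0 p f g X Y t h \<omega>) * indicator C h \<partial>prior) =
      (\<integral>h. (lik t 0 \<omega> h + lik t 1 \<omega> h) * indicator C h \<partial>prior)"
  proof (rule integral_cong_AE)
    show "AE h in prior. no_change_likelihood p\<^sub>0 p f X Y t h \<omega> *
      (1 + change_odds p\<^sub>0 p f g X Y t h \<omega>) * indicator C h = (lik t 0 \<omega> h + lik t 1 \<omega> h) * indicator C h"
      using AE by eventually_elim (simp add: lik_no_change distrib_left)
  qed (unfold lik_no_change[symmetric], measurable)
  also have "\<dots> = enn2real (\<integral>\<^sup>+h. ennreal ((lik t 0 \<omega> h + lik t 1 \<omega> h) * indicator C h) \<partial>prior)"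
    by (rule integral_eq_nn_integral) (measurable, simp add: lik_nonneg[OF \<omega>])
  also have "(\<integral>\<^sup>+h. ennreal ((lik t 0 \<omega> h + lik t 1 \<omega> h) * indicator C h) \<partial>prior) =
      (\<integral>\<^sup>+h. indicator C h * (ennreal (lik t 0 \<omega> h) + ennreal (lik t 1 \<omega> h)) \<partial>prior)"
    by (intro nn_integral_cong) (simp add: indicator_def lik_nonneg[OF \<omega>])
  finally show "(\<integral>h. no_change_likelihood p\<^sub>0 p f X Y t h \<omega> *
      (1 + change_odds p\<^sub>0 p f g X Y t h \<omega>) * indicator C h \<partial>prior) =
    enn2real (\<integral>\<^sup>+h. indicator C h * (ennreal (lik t 0 \<omega> h) + ennreal (lik t 1 \<omega> h)) \<partial>prior)" .
qed

lemma cprob_eta: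
  assumes C[measurable]: "C \<in> sets borel"
  shows "AE \<omega> in M. cprob M (obs t) {\<omega> \<in> space M. \<eta> \<omega> \<in> C} \<omega> =
    enn2real (\<integral>\<^sup>+h. indicator C h * (ennreal (lik t 0 \<omega> h) + ennreal (lik t 1 \<omega> h)) \<partial>prior) /
    enn2real (evidence t \<omega>)"
proof -
  interpret S: sigma_finite_subalgebra M "obs t"
    by (intro finite_measure_subalgebra_is_sigma_finite finite_measure_subalgebra.intro
        finite_measure_axioms finite_measure_subalgebra_axioms.intro subalgebra_obs)
  define W where "W \<omega> = (\<integral>\<^sup>+h. indicator C h * (ennreal (lik t 0 \<omega> h) + ennreal (lik t 1 \<omega> h)) \<partial>prior)" for \<omega>
  define c where "c \<omega> = enn2real (W \<omega>) / enn2real (evidence t \<omega>)" for \<omega>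
  define B where "B = {\<omega> \<in> space M. \<eta> \<omega> \<in> C}"
  have [measurable]: "B \<in> sets M" unfolding B_def by measurable
  have [measurable]: "W \<in> borel_measurable (obs t)" unfolding W_def by measurable
  have c[measurable]: "c \<in> borel_measurable (obs t)" unfolding c_def by measurable
  have cM[measurable]: "c \<in> borel_measurable M" by (rule measurable_from_subalg[OF subalgebra_obs c])
  have W_le: "W \<omega> \<le> evidence t \<omega>" for \<omega>
    unfolding W_def evidence_def by (intro nn_integral_mono) (auto simp: indicator_def)
  have c0: "0 \<le> c \<omega>" for \<omega> by (simp add: c_def)
  have c1: "c \<omega> \<le> 1" for \<omega>
    using W_le[of \<omega>] by (cases "evidence t \<omega> = \<top>")
      (auto simp: c_def divide_le_eq_1 less_top enn2real_mono less_le[of 0])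
  have ev: "AE \<omega> in M. evidence t \<omega> \<noteq> 0 \<and> evidence t \<omega> \<noteq> \<top>"
    using filter_formula[of t] by (simp add: filter_formula_def)
  have c_eq: "AE \<omega> in M. ennreal (c \<omega>) = W \<omega> * inverse (evidence t \<omega>)"
    using ev
  proof eventually_elim
    fix \<omega> assume ev: "evidence t \<omega> \<noteq> 0 \<and> evidence t \<omega> \<noteq> \<top>"
    then have "W \<omega> \<noteq> \<top>" using W_le[of \<omega>] by (auto simp: top_unique)
    with ev show "ennreal (c \<omega>) = W \<omega> * inverse (evidence t \<omega>)"
      unfolding c_def
      by (subst divide_ennreal[symmetric])
         (auto simp: divide_ennreal_def enn2real_positive_iff less_top zero_less_iff_neq_zero)
  qed
  have "AE \<omega> in M. real_cond_exp M (obs t) (indicator B) \<omega> = c \<omega>"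
  proof (rule S.real_cond_exp_charact)
    show "integrable M c"
      by (rule integrable_const_bound[where B=1]) (use c0 c1 in auto)
    show "integrable M (indicator B :: 'w \<Rightarrow> real)"
      by (rule integrable_real_indicator) (auto simp: less_top[symmetric])
    fix A assume A[measurable]: "A \<in> sets (obs t)"
    then have [measurable]: "A \<in> sets M" using obs_subset[of t] by auto
    have I: "(\<integral>\<^sup>+\<omega>. indicator A \<omega> * indicator C (\<eta> \<omega>) * indicator (in_state t i) \<omega> \<partial>M) =
      (\<integral>\<^sup>+\<omega>. indicator A \<omega> * (\<integral>\<^sup>+h. indicator C h * ennreal (lik t i \<omega> h) \<partial>prior) * inverse (evidence t \<omega>) \<partial>M)"
      (is "_ = integral\<^sup>N M (?I i)") if i: "i \<in> {0, 1}" for i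
    proof -
      have "(\<integral>\<^sup>+\<omega>. indicator A \<omega> * indicator C (\<eta> \<omega>) * indicator (in_state t i) \<omega> \<partial>M) =
          (\<integral>\<^sup>+\<omega>. (\<integral>\<^sup>+h. indicator A \<omega> * indicator C h *
            (ennreal (lik t i \<omega> h) * inverse (evidence t \<omega>)) \<partial>prior) \<partial>M)"
        using filter_formulaD[OF filter_formula i, of "\<lambda>(\<omega>, h). indicator A \<omega> * indicator C h"] by simp
      also have "\<dots> = (\<integral>\<^sup>+\<omega>. indicator A \<omega> * (\<integral>\<^sup>+h. indicator C h * ennreal (lik t i \<omega> h) \<partial>prior) * inverse (evidence t \<omega>) \<partial>M)"
      proof (rule nn_integral_cong)
        fix \<omega> assume "\<omega> \<in> space M"
        then have [measurable]: "\<omega> \<in> space (obs t)" by simp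
        show "(\<integral>\<^sup>+h. indicator A \<omega> * indicator C h *
            (ennreal (lik t i \<omega> h) * inverse (evidence t \<omega>)) \<partial>prior) =
          indicator A \<omega> * (\<integral>\<^sup>+h. indicator C h * ennreal (lik t i \<omega> h) \<partial>prior) * inverse (evidence t \<omega>)"
          by (subst nn_integral_cmult[symmetric], measurable,
              subst nn_integral_multc[symmetric], measurable) (simp add: mult.assoc)
      qed
      finally show ?thesis .
    qed
    have "(\<integral>\<omega>\<in>A. indicator B \<omega> \<partial>M) = enn2real (\<integral>\<^sup>+\<omega>. ennreal (indicator A \<omega> *\<^sub>R indicator B \<omega>) \<partial>M)"
      unfolding set_lebesgue_integral_def by (rule integral_eq_nn_integral) auto
    also have "(\<integral>\<^sup>+\<omega>. ennreal (indicator A \<omega> *\<^sub>R indicator B \<omega>) \<partial>M) =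
        (\<integral>\<^sup>+\<omega>. indicator A \<omega> * indicator C (\<eta> \<omega>) * indicator (in_state t 0) \<omega> +
          indicator A \<omega> * indicator C (\<eta> \<omega>) * indicator (in_state t 1) \<omega> \<partial>M)"
      by (intro nn_integral_cong) (auto simp: indicator_def B_def latent_def)
    also have "\<dots> = (\<integral>\<^sup>+\<omega>. indicator A \<omega> * indicator C (\<eta> \<omega>) * indicator (in_state t 0) \<omega> \<partial>M) +
          (\<integral>\<^sup>+\<omega>. indicator A \<omega> * indicator C (\<eta> \<omega>) * indicator (in_state t 1) \<omega> \<partial>M)"
      by (rule nn_integral_add) measurable
    also have "\<dots> = (\<integral>\<^sup>+\<omega>. ?I 0 \<omega> \<partial>M) + (\<integral>\<^sup>+\<omega>. ?I 1 \<omega> \<partial>M)"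
      using I[of 0] I[of 1] by simp
    also have "\<dots> = (\<integral>\<^sup>+\<omega>. ?I 0 \<omega> + ?I 1 \<omega> \<partial>M)"
      by (rule nn_integral_add[symmetric]) measurable
    also have "\<dots> = (\<integral>\<^sup>+\<omega>. indicator A \<omega> * (W \<omega> * inverse (evidence t \<omega>)) \<partial>M)"
    proof (rule nn_integral_cong)
      fix \<omega> assume "\<omega> \<in> space M"
      then have [measurable]: "\<omega> \<in> space (obs t)" by simp
      have "W \<omega> = (\<integral>\<^sup>+h. indicator C h * ennreal (lik t 0 \<omega> h) \<partial>prior) +
          (\<integral>\<^sup>+h. indicator C h * ennreal (lik t 1 \<omega> h) \<partial>prior)"
        unfolding W_def distrib_left by (rule nn_integral_add) measurable
      then show "?I 0 \<omega> + ?I 1 \<omega> = indicator A \<omega> * (W \<omega> * inverse (evidence t \<omega>))"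
        by (simp add: distrib_left distrib_right mult.assoc)
    qed
    also have "\<dots> = (\<integral>\<^sup>+\<omega>. ennreal (indicator A \<omega> *\<^sub>R c \<omega>) \<partial>M)"
      by (rule nn_integral_cong_AE) (use c_eq in eventually_elim, simp add: indicator_def)
    also have "enn2real \<dots> = (\<integral>\<omega>\<in>A. c \<omega> \<partial>M)"
      unfolding set_lebesgue_integral_def
      by (rule integral_eq_nn_integral[symmetric]) (auto simp: c0)
    finally show "(\<integral>\<omega>\<in>A. indicator B \<omega> \<partial>M) = (\<integral>\<omega>\<in>A. c \<omega> \<partial>M)" .
  qed measurable
  then show ?thesis by (simp add: cprob_def c_def W_def B_def)
qed

lemma posterior_formula:
  assumes C: "C \<in> sets borel"
  shows "AE \<omega> in M.
    cprob M (obs t) {\<omega> \<in> space M. \<eta> \<omega> \<in> C} \<omega> =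
      (\<integral>h. no_change_likelihood p\<^sub>0 p f X Y t h \<omega> * (1 + change_odds p\<^sub>0 p f g X Y t h \<omega>)
            * indicator C h \<partial>prior) /
      (\<integral>h. no_change_likelihood p\<^sub>0 p f X Y t h \<omega> * (1 + change_odds p\<^sub>0 p f g X Y t h \<omega>) \<partial>prior)"
proof -
  have "AE \<omega> in M. (\<integral>h. no_change_likelihood p\<^sub>0 p f X Y t h \<omega> *
      (1 + change_odds p\<^sub>0 p f g X Y t h \<omega>) \<partial>prior) = enn2real (evidence t \<omega>)"
    using integral_posterior_weight[of UNIV t] by (simp add: evidence_def)
  with cprob_eta[OF C, of t] integral_posterior_weight[OF C, of t] show ?thesis
    by eventually_elim simp
qed

end

theorem lemmaH1:
  fixes M :: "'w measure" and K :: nat and \<Theta> :: "'w \<Rightarrow> enat"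
    and X :: "nat \<Rightarrow> 'w \<Rightarrow> nat" and Y :: "nat \<Rightarrow> 'w \<Rightarrow> 'y::polish_space"
    and \<eta> :: "'w \<Rightarrow> 'h::polish_space" and prior :: "'h measure" and \<mu> :: "'y measure"
    and p\<^sub>0 :: "'h \<Rightarrow> real" and p :: "nat \<Rightarrow> 'h \<Rightarrow> (nat \<Rightarrow> nat) \<Rightarrow> real"
    and f g :: "nat \<Rightarrow> 'h \<Rightarrow> 'y \<Rightarrow> real"
    and t :: nat and C :: "'h set"
  assumes "change_point_model M K \<Theta> X Y \<eta> prior \<mu> p\<^sub>0 p f g"
    and "C \<in> sets borel"
  shows "AE \<omega> in M.
    cprob M (obs_algebra M X Y t) {\<omega> \<in> space M. \<eta> \<omega> \<in> C} \<omega> =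
      (\<integral>h. no_change_likelihood p\<^sub>0 p f X Y t h \<omega> * (1 + change_odds p\<^sub>0 p f g X Y t h \<omega>)
            * indicator C h \<partial>prior) /
      (\<integral>h. no_change_likelihood p\<^sub>0 p f X Y t h \<omega> * (1 + change_odds p\<^sub>0 p f g X Y t h \<omega>) \<partial>prior)"
  using assms by (rule change_point_model.posterior_formula)

end
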